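(* Let $\operatorname{Re}(\epsilon)<B^p_\epsilon$. For $\epsilon\in\mathbb{S}(k,m)$, $k\in\mathbb{Z}$, $m\in\{0,\dots,2p-1\}$, the regularised quantum dimensions of the $\mathcal{M}(p)$-modules $M_{r,s}$ ($r\in\mathbb{Z}$, $1\le s\le p$) are $$\operatorname{qdim}[M^\epsilon_{r,s}]=\begin{cases}(-1)^{m(r-1)}\dfrac{\sin(\pi ms/p)}{\sin(\pi m/p)} & \text{if } m\ne0,p,\\[2mm](-1)^{(m+1)(r-1)+\frac mp(s-1)}\dfrac{\sin(\pi s/p)}{\sin(\pi/p)}&\text{if } m=0,p.\end{cases}$$
   Context: Let $p\ge2$ be an integer, $q=e^{2\pi i\tau}$ (with $q^x:=e^{2\pi i\tau x}$), $\eta$ the Dedekind eta function. The singlet vertex operator algebra $\mathcal{M}(p)$ is the kernel of a screening operator on the rank one Heisenberg vertex algebra; $M_{r,s}$ ($r\in\mathbb{Z}$, $1\le s\le p$) are its irreducible modules labelled by a discrete set, with $M_{1,1}=\mathcal{M}(p)$ the vacuum module. Their $\epsilon$-regularised characters ($\epsilon\in\mathbb{C}$) are $$\mathrm{ch}[M^\epsilon_{r,s}](\tau)=\frac1{\eta(\tau)}\sum_{k\ge0}\left(e^{-2\pi\epsilon\sqrt{2p}\,u_k^-}q^{p(u_k^-)^2}-e^{-2\pi\epsilon\sqrt{2p}\,u_k^+}q^{p(u_k^+)^2}\right),\qquad u_k^{\pm}=k+\tfrac{2-r}{2}\pm\tfrac{s}{2p}.$$ The regularised quantum dimension is $\operatorname{qdim}[M^\epsilon]=\lim_{y\to0^+}\mathrm{ch}[M^\epsilon](iy)/\mathrm{ch}[M_{1,1}^\epsilon](iy)$.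 Further, $B^p_\epsilon=-\min\{|\frac{m}{\sqrt{2p}}-\operatorname{Im}(\epsilon)| : m\in\mathbb{Z}\setminus p\mathbb{Z}\}$, and $$\mathbb{S}(k,m)=\left\{\epsilon\in\mathbb{C}: k+\tfrac{2m-1}{4p}<\tfrac{\operatorname{Im}(\epsilon)}{\sqrt{2p}}<k+\tfrac{2m+1}{4p}\right\}.$$
   Formalization: For m=0 or m=p the formal theorem also assumes that ε is off the centre line Im(ε)/√(2p) = k + m/(2p); on that line the leading terms cancel along a sequence y→0, the vacuum character has zeros accumulating at 0, and the limit defining the quantum dimension fails to exist. *)

theory Defs
  imports "HOL-Analysis.Analysis"
begin

definition dedekind_eta :: "complex \<Rightarrow> complex" where
  "dedekind_eta \<tau> =
     exp (2 * of_real pi * \<i> * \<tau> / 24) *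
     (\<Prod>n. 1 - exp (2 * of_real pi * \<i> * \<tau> * of_nat (Suc n)))"

(* q^x for q = exp(2 pi i tau): the branch is fixed by tau, so this is not a function of q. *)
definition q_pow :: "complex \<Rightarrow> real \<Rightarrow> complex" where
  "q_pow \<tau> x = exp (2 * of_real pi * \<i> * \<tau> * of_real x)"

definition u_minus :: "nat \<Rightarrow> int \<Rightarrow> nat \<Rightarrow> nat \<Rightarrow> real" where
  "u_minus p r s k = real k + (2 - real_of_int r) / 2 - real s / (2 * real p)"

definition u_plus :: "nat \<Rightarrow> int \<Rightarrow> nat \<Rightarrow> nat \<Rightarrow> real" where
  "u_plus p r s k = real k + (2 - real_of_int r) / 2 + real s / (2 * real p)"

(* The epsilon-regularised character of the module M_{r,s} of the singlet algebra M(p);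
   M_{1,1} is the vacuum module. *)
definition reg_char :: "nat \<Rightarrow> int \<Rightarrow> nat \<Rightarrow> complex \<Rightarrow> complex \<Rightarrow> complex" where
  "reg_char p r s \<epsilon> \<tau> =
     1 / dedekind_eta \<tau> *
     (\<Sum>k. exp (- 2 * of_real pi * \<epsilon> * of_real (sqrt (2 * real p) * u_minus p r s k))
              * q_pow \<tau> (real p * (u_minus p r s k)\<^sup>2)
          - exp (- 2 * of_real pi * \<epsilon> * of_real (sqrt (2 * real p) * u_plus p r s k))
              * q_pow \<tau> (real p * (u_plus p r s k)\<^sup>2))"

(* The limit y -> 0+ of the quotient of characters exists and equals d. As x / 0 = 0, it is
   required separately that the quotient is an honest one for all small y > 0. *)
definition has_reg_qdim :: "nat \<Rightarrow> int \<Rightarrow> nat \<Rightarrow> complex \<Rightarrow> complex \<Rightarrow> bool" where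
  "has_reg_qdim p r s \<epsilon> d \<longleftrightarrow>
     (\<forall>\<^sub>F y in at_right (0::real). reg_char p 1 1 \<epsilon> (\<i> * of_real y) \<noteq> 0) \<and>
     ((\<lambda>y. reg_char p r s \<epsilon> (\<i> * of_real y) / reg_char p 1 1 \<epsilon> (\<i> * of_real y))
        \<longlongrightarrow> d) (at_right (0::real))"

(* The minimum of an infinite set of reals is written as an infimum;
   reg_bound_attained shows that it is attained for p >= 2. *)
definition reg_bound :: "nat \<Rightarrow> complex \<Rightarrow> real" where
  "reg_bound p \<epsilon> =
     - (INF m\<in>{m::int. \<not> int p dvd m}. \<bar>real_of_int m / sqrt (2 * real p) - Im \<epsilon>\<bar>)"

(* The centre line of strip p k m is Im eps / sqrt (2p) = k + m/(2p). For m = 0 and m = p the two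
   leading terms of the Poisson-resummed characters have equal modulus and opposite sign there;
   they cancel along a sequence y -> 0, so that the limit of the quotient of characters does not
   exist. Statements about the limit must leave out these two centre lines. *)
definition strip :: "nat \<Rightarrow> int \<Rightarrow> nat \<Rightarrow> complex set" where
  "strip p k m =
     {\<epsilon>. real_of_int k + (2 * real m - 1) / (4 * real p) < Im \<epsilon> / sqrt (2 * real p) \<and>
         Im \<epsilon> / sqrt (2 * real p) < real_of_int k + (2 * real m + 1) / (4 * real p)}"

lemma reg_bound_attained:
  assumes "p \<ge> 2"
  shows "\<exists>m::int. \<not> int p dvd m \<and>
           reg_bound p \<epsilon> = - \<bar>real_of_int m / sqrt (2 * real p) - Im \<epsilon>\<bar>"
proof -
  define f where "f = (\<lambda>m::int. \<bar>real_of_int m / sqrt (2 * real p) - Im \<epsilon>\<bar>)"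
  define c where "c = sqrt (2 * real p)"
  have c: "c > 0" using assms by (simp add: c_def)
  define A where "A = {m::int. \<not> int p dvd m}"
  define B where "B = {m \<in> A. f m \<le> f 1}"
  have one: "1 \<in> B" using assms by (auto simp: A_def B_def)
  have "B \<subseteq> {\<lfloor>c * (Im \<epsilon> - f 1)\<rfloor>..\<lceil>c * (Im \<epsilon> + f 1)\<rceil>}"
  proof
    fix m assume "m \<in> B"
    then have "\<bar>real_of_int m / c - Im \<epsilon>\<bar> \<le> f 1" by (simp add: B_def f_def c_def)
    then have "Im \<epsilon> - f 1 \<le> real_of_int m / c" "real_of_int m / c \<le> Im \<epsilon> + f 1"
      by (auto simp: abs_le_iff)
    then have "c * (Im \<epsilon> - f 1) \<le> m" "m \<le> c * (Im \<epsilon> + f 1)"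
      using c by (auto simp: field_simps)
    then show "m \<in> {\<lfloor>c * (Im \<epsilon> - f 1)\<rfloor>..\<lceil>c * (Im \<epsilon> + f 1)\<rceil>}"
      by (simp add: floor_le_iff le_ceiling_iff)
  qed
  then have fin: "finite B" by (rule finite_subset) simp
  have "\<exists>m\<in>B. \<forall>n\<in>B. f m \<le> f n"
    using fin one by (metis arg_min_if_finite(1) arg_min_least empty_iff)
  then obtain m where m: "m \<in> B" "\<And>n. n \<in> B \<Longrightarrow> f m \<le> f n" by blast
  have "f m \<le> f n" if "n \<in> A" for n
  proof (cases "n \<in> B")
    case False
    then show ?thesis using m(2)[OF one] that by (simp add: B_def)
  qed (rule m(2))
  then have "(INF n\<in>A. f n) = f m"
    using m(1) by (intro cInf_eq_minimum) (auto simp: B_def)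
  then show ?thesis
    using m(1) by (auto simp: reg_bound_def f_def A_def B_def)
qed

end

theory Submission
  imports Defs "HOL-Probability.Characteristic_Functions"
begin

text \<open>
The \<open>k\<close>-sum in a character runs over half of the lattice \<open>c + \<int>\<close>.  Adding the other half changes
it by an amount that stays bounded as \<open>y \<rightarrow> 0\<close>, because \<open>Re \<epsilon> < 0\<close> turns the factors
\<open>exp (-2 \<pi> \<epsilon> sqrt (2 p) u)\<close> with \<open>u \<rightarrow> -\<infinity>\<close> into a convergent geometric series.  The completed sum is
a Gaussian theta series with complex argument, and Poisson summation turns it into
\<open>1 / sqrt (2 p y) * (\<Sum>n. w n * exp (\<lambda> n / y))\<close> with
\<open>\<lambda> n = \<pi> (\<epsilon> + \<i> n / sqrt (2 p))\<^sup>2\<close>, where only the weights \<open>w n\<close> depend on the module.  The weight is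
\<open>-2 \<i> (-1)^(n r) sin (\<pi> n s / p)\<close>, the difference of the phases of the two lattices \<open>c\<^sup>- + \<int>\<close> and
\<open>c\<^sup>+ + \<int>\<close>, and it vanishes when \<open>p\<close> divides \<open>n\<close>.

As \<open>y \<rightarrow> 0\<close> the term with the largest \<open>Re (\<lambda> n)\<close> among those with \<open>n\<close> not divisible by
\<open>p\<close> wins, that is, the one for which
\<open>M = -n\<close> is the integer not divisible by \<open>p\<close> that is nearest to
\<open>sqrt (2 p) Im \<epsilon>\<close>.  The bound on \<open>Re \<epsilon>\<close> says that \<open>Re \<epsilon> < 0\<close> and \<open>Re (\<lambda> (-M)) > 0\<close>, so
that this term also dominates the bounded half that was added.  Hence the quantum dimension is the quotient of the two
weights at \<open>-M\<close>, namely \<open>(-1)^(M (r-1)) sin (\<pi> M s / p) / sin (\<pi> M / p)\<close>.  In the strip with label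
\<open>(k, m)\<close> the integer nearest to \<open>sqrt (2 p) Im \<epsilon>\<close> is \<open>N = 2 p k + m\<close>; this is \<open>M\<close> unless \<open>m = 0\<close> or
\<open>m = p\<close>, when \<open>p\<close> divides \<open>N\<close> and \<open>M\<close> is whichever of \<open>N + 1\<close>, \<open>N - 1\<close> lies on the same side of
\<open>N\<close> as \<open>sqrt (2 p) Im \<epsilon>\<close>.  Both choices give the same quotient.

Poisson summation (\<open>theta_inversion\<close>) rests on the convergence of the Fourier series of a
periodic function at a point where it satisfies a Lipschitz condition (\<open>fourier_series_at_0\<close>) and on
the Fourier transform of a Gaussian with a complex shift
(\<open>has_bochner_integral_gaussian_harmonic\<close>).  Tannery's theorem isolates the dominant term
(\<open>dual_series_tendsto\<close>), and \<open>has_reg_qdim_dominant\<close> combines this with the bound on the added half.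
\<close>

section \<open>Pointwise convergence of Fourier series\<close>

text \<open>
The interval is half open so that its integer translates partition the line; this makes unfolding a
periodised integrand an identity of indicator functions.
\<close>

abbreviation unit_interval :: "real measure" where
  "unit_interval \<equiv> restrict_space lborel {0..<1}"

definition harmonic :: "int \<Rightarrow> real \<Rightarrow> complex" where
  "harmonic n x = exp (2 * of_real pi * \<i> * of_int n * of_real x)"

definition fourier_coeff :: "(real \<Rightarrow> complex) \<Rightarrow> int \<Rightarrow> complex" where
  "fourier_coeff f n = (LINT x|unit_interval. f x * harmonic (- n) x)"

lemma prob_space_unit_interval: "prob_space unit_interval"
  by (rule prob_spaceI) (simp add: space_restrict_space emeasure_restrict_space)

interpretation unit_interval: prob_space unit_interval
  by (rule prob_space_unit_interval)

lemma harmonic_measurable [measurable]: "harmonic n \<in> borel_measurable borel"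
  unfolding harmonic_def by measurable

lemma harmonic_0 [simp]: "harmonic 0 x = 1"
  by (simp add: harmonic_def)

lemma norm_harmonic [simp]: "norm (harmonic n x) = 1"
  by (simp add: harmonic_def)

lemma harmonic_add: "harmonic (m + n) x = harmonic m x * harmonic n x"
  by (simp add: harmonic_def exp_add[symmetric] algebra_simps)

lemma cnj_harmonic: "cnj (harmonic n x) = harmonic (- n) x"
  by (simp add: harmonic_def exp_cnj)

lemma harmonic_shift: "harmonic n (x + of_int k) = harmonic n x"
proof -
  have "harmonic n (x + of_int k) =
      harmonic n x * exp (2 * of_int (n * k) * of_real pi * \<i>)"
    by (simp add: harmonic_def exp_add[symmetric] algebra_simps)
  also have "exp (2 * of_int (n * k) * of_real pi * \<i>) = 1"
    using exp_integer_2pi[of "of_int (n * k)"] by (simp only: Ints_of_int) (simp add: mult_ac)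
  finally show ?thesis by simp
qed

lemma harmonic_orthogonal:
  "(LINT x|unit_interval. harmonic n x) = (if n = 0 then 1 else 0)"
proof (cases "n = 0")
  case True
  then show ?thesis
    using unit_interval.prob_space by simp
next
  case False
  define c where "c = 2 * complex_of_real pi * \<i> * of_int n"
  have c: "c \<noteq> 0" using False by (simp add: c_def)
  have "(LINT x|unit_interval. harmonic n x) = (LBINT x=0..1. harmonic n x)"
    using interval_integral_Ico[of 0 1 "harmonic n"]
    by (simp add: integral_restrict_space set_lebesgue_integral_def zero_ereal_def one_ereal_def)
  also have "\<dots> = exp (c * of_real 1) / c - exp (c * of_real 0) / c"
    unfolding zero_ereal_def one_ereal_def
  proof (rule interval_integral_FTC_finite)
    show "continuous_on {min 0 1..max 0 (1::real)} (harmonic n)"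
      unfolding harmonic_def by (intro continuous_intros)
    fix x :: real
    have "((\<lambda>z. exp (c * z) / c) has_field_derivative exp (c * of_real x)) (at (of_real x))"
      using c by (auto intro!: derivative_eq_intros)
    from has_vector_derivative_real_field[OF this]
    show "((\<lambda>x. exp (c * of_real x) / c) has_vector_derivative harmonic n x)
        (at x within {min 0 1..max 0 1})"
      by (simp add: harmonic_def c_def)
  qed
  also have "exp (c * of_real 1) = 1"
    using exp_integer_2pi[of "of_int n"] by (simp add: c_def mult_ac)
  finally show ?thesis using False by simp
qed

lemma integrable_unit_interval:
  fixes f :: "real \<Rightarrow> complex"
  assumes "f \<in> borel_measurable borel" "\<And>x. 0 \<le> x \<Longrightarrow> x < 1 \<Longrightarrow> norm (f x) \<le> B"
  shows "integrable unit_interval f"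
  using assms
  by (intro unit_interval.integrable_const_bound[where B = B] AE_I2)
     (auto simp: space_restrict_space intro: measurable_restrict_space1)

text \<open>
Integrate \<open>\<bar>f - h\<bar>\<^sup>2 \<ge> 0\<close> for the partial Fourier sum \<open>h\<close>.  By orthogonality both \<open>\<integral> f cnj h\<close> and
\<open>\<integral> \<bar>h\<bar>\<^sup>2\<close> are equal to the sum of the squared coefficients.
\<close>

lemma bessel_inequality:
  assumes [measurable]: "f \<in> borel_measurable borel"
    and bound: "\<And>x. 0 \<le> x \<Longrightarrow> x < 1 \<Longrightarrow> norm (f x) \<le> B"
    and "finite A"
  shows "(\<Sum>n\<in>A. (norm (fourier_coeff f n))\<^sup>2) \<le> B\<^sup>2"
proof -
  define c where "c = fourier_coeff f"
  define h where "h x = (\<Sum>n\<in>A. c n * harmonic n x)" for x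
  have h_meas [measurable]: "h \<in> borel_measurable borel"
    unfolding h_def by measurable
  have [measurable]: "cnj \<in> borel_measurable borel"
    by (intro borel_measurable_continuous_onI continuous_intros)
  define S where "S = (\<Sum>n\<in>A. (norm (c n))\<^sup>2)"
  have B0: "B \<ge> 0" using bound[of 0] norm_ge_zero[of "f 0"] by linarith
  have h_bound: "norm (h x) \<le> (\<Sum>n\<in>A. norm (c n))" for x
    unfolding h_def by (rule order_trans[OF norm_sum]) (simp add: norm_mult)
  have int_fh: "integrable unit_interval (\<lambda>x. f x * cnj (h x))"
    by (rule integrable_unit_interval[where B = "B * (\<Sum>n\<in>A. norm (c n))"])
       (auto simp: norm_mult intro!: mult_mono bound h_bound B0)
  have int_hh: "integrable unit_interval (\<lambda>x. h x * cnj (h x))"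
    by (rule integrable_unit_interval
         [where B = "(\<Sum>n\<in>A. norm (c n)) * (\<Sum>n\<in>A. norm (c n))"])
       (auto simp: norm_mult intro!: mult_mono h_bound sum_nonneg)
  have int_ff: "integrable unit_interval (\<lambda>x. f x * cnj (f x))"
    by (rule integrable_unit_interval[where B = "B * B"])
       (auto simp: norm_mult intro!: mult_mono bound B0)
  have int_fn: "integrable unit_interval (\<lambda>x. f x * harmonic n x)" for n
    by (rule integrable_unit_interval[where B = B]) (auto simp: norm_mult bound)
  have int_hn: "integrable unit_interval (harmonic n)" for n
    by (rule integrable_unit_interval[where B = 1]) auto
  have fh: "(LINT x|unit_interval. f x * cnj (h x)) = of_real S"
  proof -
    have "(LINT x|unit_interval. f x * cnj (h x)) =
        (LINT x|unit_interval. (\<Sum>n\<in>A. cnj (c n) * (f x * harmonic (- n) x)))"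
      by (simp add: h_def cnj_harmonic sum_distrib_left mult_ac)
    also have "\<dots> = (\<Sum>n\<in>A. cnj (c n) * c n)"
      by (subst Bochner_Integration.integral_sum)
         (auto simp: c_def fourier_coeff_def intro!: int_fn integrable_mult_right)
    also have "\<dots> = of_real S"
      by (simp add: S_def complex_norm_square mult.commute del: of_real_power)
    finally show ?thesis .
  qed
  have hh: "(LINT x|unit_interval. h x * cnj (h x)) = of_real S"
  proof -
    have "(LINT x|unit_interval. h x * cnj (h x)) =
        (LINT x|unit_interval. (\<Sum>n\<in>A. \<Sum>m\<in>A. cnj (c n) * c m * harmonic (m + (- n)) x))"
      unfolding h_def harmonic_add
      by (simp add: cnj_harmonic sum_distrib_left sum_distrib_right mult_ac)
    also have "\<dots> = (\<Sum>n\<in>A. \<Sum>m\<in>A. cnj (c n) * c m * (if m + (- n) = 0 then 1 else 0))"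
      by (simp add: Bochner_Integration.integral_sum int_hn integrable_mult_right
            harmonic_orthogonal del: mult_cancel_left)
    also have "\<dots> = (\<Sum>n\<in>A. cnj (c n) * c n)"
      using \<open>finite A\<close> by (intro sum.cong refl) (simp add: if_distrib sum.delta cong: if_cong)
    also have "\<dots> = of_real S"
      by (simp add: S_def complex_norm_square mult.commute del: of_real_power)
    finally show ?thesis .
  qed
  have "0 \<le> (LINT x|unit_interval. (norm (f x - h x))\<^sup>2)"
    by simp
  also have "\<dots> = (LINT x|unit_interval.
      Re (f x * cnj (f x) - 2 * (f x * cnj (h x)) + h x * cnj (h x)))"
  proof (intro Bochner_Integration.integral_cong refl)
    fix x
    show "(norm (f x - h x))\<^sup>2 = Re (f x * cnj (f x) - 2 * (f x * cnj (h x)) + h x * cnj (h x))"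
      unfolding cmod_power2 by (simp add: power2_eq_square algebra_simps)
  qed
  also have "\<dots> = Re (LINT x|unit_interval.
      f x * cnj (f x) - 2 * (f x * cnj (h x)) + h x * cnj (h x))"
    by (intro integral_Re Bochner_Integration.integrable_add Bochner_Integration.integrable_diff
        integrable_mult_right int_ff int_fh int_hh)
  also have "\<dots> = Re (LINT x|unit_interval. f x * cnj (f x)) - S"
    using int_ff int_fh int_hh
    by (simp add: fh hh integrable_mult_right Bochner_Integration.integral_add
        Bochner_Integration.integral_diff del: complex_mult_cnj)
  also have "Re (LINT x|unit_interval. f x * cnj (f x)) \<le> B\<^sup>2"
  proof -
    have "norm (LINT x|unit_interval. f x * cnj (f x)) \<le>
        (LINT x|unit_interval. norm (f x * cnj (f x)))"
      by (rule integral_norm_bound)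
    also have "\<dots> \<le> (LINT x|unit_interval. B\<^sup>2)"
      by (intro integral_mono integrable_norm int_ff)
         (auto simp: space_restrict_space norm_mult power2_eq_square intro!: mult_mono bound B0)
    finally have "norm (LINT x|unit_interval. f x * cnj (f x)) \<le> B\<^sup>2"
      using unit_interval.prob_space by simp
    then show ?thesis
      using complex_Re_le_cmod order_trans by blast
  qed
  finally show ?thesis by (simp add: S_def c_def)
qed

lemma riemann_lebesgue:
  assumes "f \<in> borel_measurable borel" "\<And>x. 0 \<le> x \<Longrightarrow> x < 1 \<Longrightarrow> norm (f x) \<le> B"
    and "inj (\<sigma> :: nat \<Rightarrow> int)"
  shows "(\<lambda>n. fourier_coeff f (\<sigma> n)) \<longlonglongrightarrow> 0"
proof -
  have "summable (\<lambda>n. (norm (fourier_coeff f (\<sigma> n)))\<^sup>2)"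
  proof (rule summableI_nonneg_bounded[where x = "B\<^sup>2"])
    fix n
    have "(\<Sum>i<n. (norm (fourier_coeff f (\<sigma> i)))\<^sup>2) =
        (\<Sum>i\<in>\<sigma> ` {..<n}. (norm (fourier_coeff f i))\<^sup>2)"
      using \<open>inj \<sigma>\<close> by (subst sum.reindex) (auto intro: inj_on_subset)
    also have "\<dots> \<le> B\<^sup>2"
      using assms by (intro bessel_inequality) auto
    finally show "(\<Sum>i<n. (norm (fourier_coeff f (\<sigma> i)))\<^sup>2) \<le> B\<^sup>2" .
  qed simp
  then have "(\<lambda>n. (norm (fourier_coeff f (\<sigma> n)))\<^sup>2) \<longlonglongrightarrow> 0"
    by (rule summable_LIMSEQ_zero)
  then have "(\<lambda>n. sqrt ((norm (fourier_coeff f (\<sigma> n)))\<^sup>2)) \<longlonglongrightarrow> sqrt 0"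
    by (rule tendsto_real_sqrt)
  then show ?thesis by (simp add: tendsto_norm_zero_iff)
qed

text \<open>
By concavity, the graph of the sine on \<open>[0, \<pi>/2]\<close> lies above its chord.
\<close>

lemma sin_pi_ge:
  assumes "0 \<le> x" "x \<le> 1/2"
  shows "sin (pi * x) \<ge> 2 * x"
proof -
  have "convex_on {0..pi/2} (\<lambda>x. - sin x)"
    by (rule f''_ge0_imp_convex[where f' = "\<lambda>x. - cos x" and f'' = sin])
       (auto intro!: derivative_eq_intros sin_ge_zero)
  from convex_onD[OF this, of "2 * x" 0 "pi/2"] assms
  show ?thesis by (simp add: mult.commute)
qed

text \<open>
The zeros of \<open>harmonic 1 - 1\<close> at the two ends of the period are simple; this is what makes the quotient in
the next proof bounded.
\<close>

lemma norm_harmonic_1_minus_1: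
  assumes "0 \<le> x" "x \<le> 1"
  shows "norm (harmonic 1 x - 1) \<ge> 4 * min x (1 - x)"
proof -
  have "norm (harmonic 1 x - 1) = 2 * \<bar>sin (pi * x)\<bar>"
    using dist_exp_i_1[of "2 * pi * x"] by (simp add: harmonic_def mult_ac)
  moreover have "sin (pi * x) \<ge> 2 * min x (1 - x)"
  proof (cases "x \<le> 1/2")
    case True
    then show ?thesis using sin_pi_ge[of x] assms by simp
  next
    case False
    have "sin (pi * (1 - x)) = sin (pi * x)"
      by (simp add: algebra_simps)
    then show ?thesis using sin_pi_ge[of "1 - x"] assms False by simp
  qed
  ultimately show ?thesis by linarith
qed

text \<open>
Chernoff's argument.  Write \<open>f = a + E (harmonic 1 - 1)\<close>; the Lipschitz condition at both ends of the
period makes \<open>E\<close> bounded.  Up to the constant \<open>a\<close>, the coefficients of \<open>f\<close> are then the differences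
\<open>fourier_coeff E (n - 1) - fourier_coeff E n\<close>.  The partial sums telescope, and what remains besides \<open>a\<close>
vanishes in the limit by the Riemann--Lebesgue lemma.  A bilateral series is written as a series
over \<open>\<nat>\<close> with the terms of index \<open>n\<close> and \<open>-1 - n\<close> added, so its partial sums run over
\<open>{-N..<N}\<close>.
\<close>

theorem fourier_series_at_0:
  assumes [measurable]: "f \<in> borel_measurable borel"
    and lip0: "\<And>x. 0 \<le> x \<Longrightarrow> x \<le> 1 \<Longrightarrow> norm (f x - a) \<le> L * x"
    and lip1: "\<And>x. 0 \<le> x \<Longrightarrow> x \<le> 1 \<Longrightarrow> norm (f x - a) \<le> L * (1 - x)"
  shows "(\<lambda>n. fourier_coeff f (int n) + fourier_coeff f (- 1 - int n)) sums a"
proof -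
  define E where "E x = (f x - a) / (harmonic 1 x - 1)" for x
  have [measurable]: "E \<in> borel_measurable borel"
    unfolding E_def by measurable
  have L0: "L \<ge> 0" using lip0[of 1] norm_ge_zero[of "f 1 - a"] by linarith
  have E_bound: "norm (E x) \<le> L" if "0 \<le> x" "x < 1" for x
  proof (cases "x = 0")
    case True
    then show ?thesis using L0 by (simp add: E_def harmonic_def)
  next
    case False
    have "norm (f x - a) \<le> L * min x (1 - x)"
      using lip0[of x] lip1[of x] that by (auto simp: min_def)
    also have "\<dots> \<le> L * norm (harmonic 1 x - 1)"
      using norm_harmonic_1_minus_1[of x] that L0
      by (intro mult_left_mono) (auto simp: min_def split: if_splits)
    finally show ?thesis
      using norm_harmonic_1_minus_1[of x] that False L0
      by (simp add: E_def norm_divide divide_le_eq min_def split: if_splits)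
  qed
  have f_eq: "f x = a + E x * (harmonic 1 x - 1)" if "0 \<le> x" "x < 1" for x
  proof (cases "x = 0")
    case True
    then show ?thesis using lip0[of 0] by (simp add: harmonic_def)
  next
    case False
    then have "norm (harmonic 1 x - 1) > 0"
      using norm_harmonic_1_minus_1[of x] that by (auto simp: min_def split: if_splits)
    then show ?thesis by (simp add: E_def)
  qed
  have int_E: "integrable unit_interval (\<lambda>x. E x * harmonic n x)" for n
    by (rule integrable_unit_interval[where B = L]) (auto simp: norm_mult E_bound)
  have int_h: "integrable unit_interval (harmonic n)" for n
    by (rule integrable_unit_interval[where B = 1]) auto
  have coeff: "fourier_coeff f n =
      (if n = 0 then a else 0) + (fourier_coeff E (n - 1) - fourier_coeff E n)" for n
  proof -
    have "fourier_coeff f n = (LINT x|unit_interval. a * harmonic (- n) x +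
        (E x * harmonic (- (n - 1)) x - E x * harmonic (- n) x))"
      unfolding fourier_coeff_def
    proof (intro Bochner_Integration.integral_cong refl)
      fix x assume "x \<in> space unit_interval"
      then have x: "0 \<le> x" "x < 1" by (auto simp: space_restrict_space)
      have "harmonic (- (n - 1)) x = harmonic 1 x * harmonic (- n) x"
        by (simp flip: harmonic_add)
      then show "f x * harmonic (- n) x = a * harmonic (- n) x +
        (E x * harmonic (- (n - 1)) x - E x * harmonic (- n) x)"
        by (simp add: f_eq[OF x] algebra_simps)
    qed
    also have "\<dots> = a * (if - n = 0 then 1 else 0) +
        (fourier_coeff E (n - 1) - fourier_coeff E n)"
      using int_E[of "- (n - 1)"] int_E[of "- n"] int_h[of "- n"]
      unfolding fourier_coeff_def harmonic_orthogonal[symmetric]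
      by (subst Bochner_Integration.integral_add)
         (auto intro: integrable_mult_right Bochner_Integration.integrable_diff)
    finally show ?thesis by simp
  qed
  have partial: "(\<Sum>n<N. fourier_coeff f (int n) + fourier_coeff f (- 1 - int n)) =
      (if N = 0 then 0 else a) + fourier_coeff E (- 1 - int N) - fourier_coeff E (int N - 1)" for N
    by (induction N) (auto simp: coeff algebra_simps)
  have "(\<lambda>N. fourier_coeff E (- 1 - int N)) \<longlonglongrightarrow> 0"
    by (rule riemann_lebesgue[where B = L]) (auto simp: E_bound inj_def)
  moreover have "(\<lambda>N. fourier_coeff E (int N - 1)) \<longlonglongrightarrow> 0"
    by (rule riemann_lebesgue[where B = L]) (auto simp: E_bound inj_def)
  moreover have "(\<lambda>N. if N = 0 then 0 else a) \<longlonglongrightarrow> a"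
    using eventually_gt_at_top[of 0] by (intro tendsto_eventually, eventually_elim) auto
  ultimately have "(\<lambda>N. (if N = 0 then 0 else a) + fourier_coeff E (- 1 - int N)
      - fourier_coeff E (int N - 1)) \<longlonglongrightarrow> a + 0 - 0"
    by (intro tendsto_intros)
  then show ?thesis by (simp add: sums_def partial)
qed

section \<open>Poisson summation for Gaussians\<close>

definition gaussian :: "real \<Rightarrow> complex \<Rightarrow> complex" where
  "gaussian t w = exp (- of_real (pi * t) * w\<^sup>2)"

text \<open>
From \<open>(k + x)\<^sup>2 \<ge> k\<^sup>2 / 2 - x\<^sup>2\<close> and \<open>k\<^sup>2 \<ge> \<bar>k\<bar>\<close>: geometric decay, uniform on bounded sets, is all
that is needed to sum over the lattice.
\<close>

lemma norm_gaussian_le: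
  assumes "t > 0" "norm w \<le> R"
  shows "norm (gaussian t (w + of_int k)) \<le> exp (pi * t * R\<^sup>2) * exp (- pi * t / 2) ^ nat \<bar>k\<bar>"
proof -
  have "\<bar>real_of_int k\<bar> \<le> (real_of_int k)\<^sup>2"
  proof -
    have "\<bar>k\<bar> * 1 \<le> \<bar>k\<bar> * \<bar>k\<bar>"
      by (cases "k = 0") (simp, intro mult_left_mono, auto)
    then have "\<bar>k\<bar> \<le> k\<^sup>2" by (simp add: power2_eq_square)
    then show ?thesis by (metis of_int_abs of_int_le_iff of_int_power)
  qed
  moreover have "0 \<le> (real_of_int k + 2 * Re w)\<^sup>2" by simp
  moreover have "(norm w)\<^sup>2 \<le> R\<^sup>2" using assms by (intro power_mono) auto
  ultimately have "(Im w)\<^sup>2 - (Re w + k)\<^sup>2 \<le> R\<^sup>2 - \<bar>real_of_int k\<bar> / 2"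
    unfolding cmod_power2 by (simp add: power2_eq_square algebra_simps)
  then have "pi * t * ((Im w)\<^sup>2 - (Re w + k)\<^sup>2) \<le> pi * t * (R\<^sup>2 - \<bar>real_of_int k\<bar> / 2)"
    using assms by (intro mult_left_mono) auto
  moreover have "Re (- of_real (pi * t) * (w + of_int k)\<^sup>2) = pi * t * ((Im w)\<^sup>2 - (Re w + k)\<^sup>2)"
    by (simp add: power2_eq_square algebra_simps)
  moreover have "exp (- pi * t / 2) ^ nat \<bar>k\<bar> = exp (- pi * t / 2 * \<bar>real_of_int k\<bar>)"
    by (simp flip: exp_of_nat2_mult)
  ultimately show ?thesis
    by (simp add: gaussian_def norm_exp_eq_Re exp_add[symmetric] algebra_simps del: of_real_mult)
qed

text \<open>
The derivative \<open>-2 \<pi> t (v + k) * gaussian t (v + k)\<close> costs a factor of order \<open>\<bar>k\<bar>\<close> over the bound for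
the Gaussian itself.
\<close>

lemma gaussian_lipschitz:
  assumes t: "t > 0" and w: "norm w \<le> R" "norm w' \<le> R"
  shows "norm (gaussian t (w + of_int k) - gaussian t (w' + of_int k)) \<le>
    2 * pi * t * (R + 1) * exp (pi * t * R\<^sup>2) *
      (real (Suc (nat \<bar>k\<bar>)) * exp (- pi * t / 2) ^ nat \<bar>k\<bar>) * norm (w - w')"
proof (rule field_differentiable_bound[where S = "cball 0 R" and f = "\<lambda>w. gaussian t (w + of_int k)"
      and f' = "\<lambda>w. - of_real (2 * pi * t) * (w + of_int k) * gaussian t (w + of_int k)"])
  have R: "R \<ge> 0" using w(1) norm_ge_zero[of w] by linarith
  fix v assume "v \<in> cball (0::complex) R"
  then have v: "norm v \<le> R" by simp
  show "((\<lambda>w. gaussian t (w + of_int k)) has_field_derivative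
      - of_real (2 * pi * t) * (v + of_int k) * gaussian t (v + of_int k)) (at v within cball 0 R)"
    unfolding gaussian_def by (auto intro!: derivative_eq_intros)
  have "norm (v + of_int k) \<le> R + \<bar>real_of_int k\<bar>"
    using norm_triangle_ineq[of v "of_int k"] v by simp
  also have "\<dots> \<le> (R + 1) * real (Suc (nat \<bar>k\<bar>))"
    using R by (simp add: algebra_simps)
  finally have "norm (v + of_int k) * norm (gaussian t (v + of_int k)) \<le>
      (R + 1) * real (Suc (nat \<bar>k\<bar>)) *
      (exp (pi * t * R\<^sup>2) * exp (- pi * t / 2) ^ nat \<bar>k\<bar>)"
    using R by (intro mult_mono norm_gaussian_le t v) auto
  then have "2 * pi * t * (norm (v + of_int k) * norm (gaussian t (v + of_int k))) \<le> 2 * pi * t *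
      ((R + 1) * real (Suc (nat \<bar>k\<bar>)) *
      (exp (pi * t * R\<^sup>2) * exp (- pi * t / 2) ^ nat \<bar>k\<bar>))"
    using t by (intro mult_left_mono) auto
  moreover have "norm (- of_real (2 * pi * t) * (v + of_int k) * gaussian t (v + of_int k)) =
      2 * pi * t * (norm (v + of_int k) * norm (gaussian t (v + of_int k)))"
    using t unfolding norm_mult norm_minus_cancel norm_of_real by simp
  ultimately show "norm (- of_real (2 * pi * t) * (v + of_int k) * gaussian t (v + of_int k)) \<le>
      2 * pi * t * (R + 1) * exp (pi * t * R\<^sup>2) *
      (real (Suc (nat \<bar>k\<bar>)) * exp (- pi * t / 2) ^ nat \<bar>k\<bar>)"
    by (simp only: mult_ac)
qed (use w in auto)

text \<open>
Completing the square for the real part of \<open>b\<close> by a real translation and scaling reduces the integral to the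
characteristic function of the standard normal distribution, which accounts for the imaginary part.
\<close>

lemma has_bochner_integral_exp_quadratic:
  fixes a :: real and b :: complex
  assumes a: "a > 0"
  shows "has_bochner_integral lborel (\<lambda>x. exp (- of_real a * (of_real x)\<^sup>2 + b * of_real x))
    (of_real (sqrt (pi / a)) * exp (b\<^sup>2 / (4 * of_real a)))"
proof -
  define c where "c = sqrt (2 * a)"
  have c: "c > 0" "c\<^sup>2 = 2 * a" using a by (auto simp: c_def)
  define s where "s = Im b / c"
  \<comment> \<open>the constant left over by the substitution \<open>x \<mapsto> - Re b / c + c * x\<close>\<close>
  define K where "K = exp (of_real (Re b) * b / (2 * of_real a) - of_real ((Re b)\<^sup>2 / (4 * a)))"
  interpret N: prob_space std_normal_distribution
    by (rule prob_space_normal_density) simp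
  have "integrable std_normal_distribution (\<lambda>x. exp (\<i> * of_real (s * x)))"
    by (rule N.integrable_iexp) auto
  moreover have "(LINT x|std_normal_distribution. exp (\<i> * of_real (s * x))) =
      of_real (exp (- (s\<^sup>2) / 2))"
    using fun_cong[OF char_std_normal_distribution, of s] by (simp add: char_def)
  ultimately have "has_bochner_integral lborel
      (\<lambda>x. std_normal_density x *\<^sub>R exp (\<i> * of_real (s * x))) (of_real (exp (- (s\<^sup>2) / 2)))"
    unfolding has_bochner_integral_iff
    by (subst (asm) integrable_density, simp, simp, simp)
       (subst (asm) integral_density, auto)
  then have "has_bochner_integral lborel
      (\<lambda>x. std_normal_density (- Re b / c + c * x) *\<^sub>R
        exp (\<i> * of_real (s * (- Re b / c + c * x)))) (of_real (exp (- (s\<^sup>2) / 2)) /\<^sub>R \<bar>c\<bar>)"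
    using c by (subst (asm) lborel_has_bochner_integral_real_affine_iff[where c = c and t = "- Re b / c"]) auto
  then have "has_bochner_integral lborel
      (\<lambda>x. of_real (sqrt (2 * pi)) * K *
       (std_normal_density (- Re b / c + c * x) *\<^sub>R
        exp (\<i> * of_real (s * (- Re b / c + c * x)))))
      (of_real (sqrt (2 * pi)) * K *
       (of_real (exp (- (s\<^sup>2) / 2)) /\<^sub>R \<bar>c\<bar>))"
    by (rule has_bochner_integral_mult_right)
  moreover have "of_real (sqrt (2 * pi)) * K *
       (std_normal_density (- Re b / c + c * x) *\<^sub>R
        exp (\<i> * of_real (s * (- Re b / c + c * x)))) =
      exp (- of_real a * (of_real x)\<^sup>2 + b * of_real x)" for x
  proof -
    have sq: "(- Re b / c + c * x)\<^sup>2 = (Re b)\<^sup>2 / (2 * a) - 2 * Re b * x + 2 * a * x\<^sup>2"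
      unfolding c(2)[symmetric] using c(1) by (simp add: power2_eq_square field_simps)
    have lin: "s * (- Re b / c + c * x) = Im b * x - Im b * Re b / (2 * a)"
      unfolding c(2)[symmetric] using c(1) by (simp add: s_def field_simps power2_eq_square)
    have e1: "of_real (sqrt (2 * pi)) * (std_normal_density (- Re b / c + c * x) *\<^sub>R 1) =
        exp (complex_of_real (- ((Re b)\<^sup>2 / (2 * a) - 2 * Re b * x + 2 * a * x\<^sup>2) / 2))"
      unfolding std_normal_density_def sq
      by (simp add: scaleR_conv_of_real exp_of_real[symmetric] del: exp_of_real of_real_mult)
    have e2: "K *
        exp (complex_of_real (- ((Re b)\<^sup>2 / (2 * a) - 2 * Re b * x + 2 * a * x\<^sup>2) / 2)) *
        exp (\<i> * of_real (Im b * x - Im b * Re b / (2 * a))) =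
        exp (- of_real a * (of_real x)\<^sup>2 + b * of_real x)"
      unfolding K_def exp_add[symmetric]
      by (rule arg_cong[where f = exp])
         (use a in \<open>auto simp: complex_eq_iff power2_eq_square field_simps\<close>)
    show ?thesis
      unfolding lin e2[symmetric] e1[symmetric]
      by (simp only: scaleR_conv_of_real of_real_1 mult_1_right mult_1_left mult_ac)
  qed
  moreover have "of_real (sqrt (2 * pi)) * K *
       (of_real (exp (- (s\<^sup>2) / 2)) /\<^sub>R \<bar>c\<bar>) =
      of_real (sqrt (pi / a)) * exp (b\<^sup>2 / (4 * of_real a))"
  proof -
    have "K * of_real (exp (- (s\<^sup>2) / 2)) = exp (b\<^sup>2 / (4 * of_real a))"
      unfolding K_def exp_of_real[symmetric] exp_add[symmetric] s_def power_divide c(2)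
      by (rule arg_cong[where f = exp])
         (use a in \<open>auto simp: complex_eq_iff power2_eq_square field_simps\<close>)
    moreover have "sqrt (2 * pi) / c = sqrt (pi / a)"
      using a by (simp add: c_def real_sqrt_divide[symmetric])
    moreover have "of_real (sqrt (2 * pi)) * K * (of_real (exp (- (s\<^sup>2) / 2)) /\<^sub>R \<bar>c\<bar>) =
        of_real (sqrt (2 * pi) / c) * (K * of_real (exp (- (s\<^sup>2) / 2)))"
      using c(1) by (simp only: scaleR_conv_of_real divide_inverse abs_of_pos of_real_mult mult_ac)
    ultimately show ?thesis by metis
  qed
  ultimately show ?thesis by simp
qed

text \<open>
The case \<open>a = \<pi> t\<close>, \<open>b = -2 \<pi> (t z + \<i> n)\<close> of the preceding integral.
\<close>

lemma has_bochner_integral_gaussian_harmonic: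
  assumes t: "t > 0"
  shows "has_bochner_integral lborel (\<lambda>x. gaussian t (z + of_real x) * harmonic (- n) x)
    (of_real (1 / sqrt t) *
      exp (- of_real (pi * (of_int n)\<^sup>2 / t) + 2 * of_real pi * \<i> * of_int n * z))"
proof -
  define b where "b = - (2 * of_real pi * (of_real t * z + \<i> * of_int n))"
  have "has_bochner_integral lborel
      (\<lambda>x. exp (- of_real (pi * t) * z\<^sup>2) * exp (- of_real (pi * t) * (of_real x)\<^sup>2 + b * of_real x))
      (exp (- of_real (pi * t) * z\<^sup>2) *
        (of_real (sqrt (pi / (pi * t))) * exp (b\<^sup>2 / (4 * of_real (pi * t)))))"
    using t by (intro has_bochner_integral_mult_right has_bochner_integral_exp_quadratic) auto
  moreover have "exp (- of_real (pi * t) * z\<^sup>2) *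
      exp (- of_real (pi * t) * (of_real x)\<^sup>2 + b * of_real x) =
      gaussian t (z + of_real x) * harmonic (- n) x" for x
    unfolding gaussian_def harmonic_def exp_add[symmetric] b_def
    by (rule arg_cong[where f = exp]) (simp add: power2_eq_square algebra_simps)
  moreover have "exp (- of_real (pi * t) * z\<^sup>2) *
        (of_real (sqrt (pi / (pi * t))) * exp (b\<^sup>2 / (4 * of_real (pi * t)))) =
      of_real (1 / sqrt t) *
      exp (- of_real (pi * (of_int n)\<^sup>2 / t) + 2 * of_real pi * \<i> * of_int n * z)"
  proof -
    have bq: "b\<^sup>2 / (4 * of_real (pi * t)) = of_real (pi * t) * z\<^sup>2 - of_real (pi * (of_int n)\<^sup>2 / t)
        + 2 * of_real pi * \<i> * of_int n * z"
      using t by (simp add: b_def power2_eq_square field_simps)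
    have "exp (- of_real (pi * t) * z\<^sup>2) * exp (b\<^sup>2 / (4 * of_real (pi * t))) =
      exp (- of_real (pi * (of_int n)\<^sup>2 / t) + 2 * of_real pi * \<i> * of_int n * z)"
      unfolding exp_add[symmetric] bq by simp
    moreover have "sqrt (pi / (pi * t)) = 1 / sqrt t"
      by (simp add: real_sqrt_divide)
    ultimately show ?thesis by (simp add: mult_ac)
  qed
  ultimately show ?thesis by simp
qed

lemma summable_Suc_power_int:
  assumes "0 \<le> r" "r < (1::real)"
  shows "summable (\<lambda>n. real (Suc (nat \<bar>int n\<bar>)) * r ^ nat \<bar>int n\<bar>)"
    and "summable (\<lambda>n. real (Suc (nat \<bar>- 1 - int n\<bar>)) * r ^ nat \<bar>- 1 - int n\<bar>)"
proof -
  have *: "summable (\<lambda>n. real (Suc n) * r ^ n)"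
    using geometric_deriv_sums[of r] assms by (auto simp: sums_iff)
  then show "summable (\<lambda>n. real (Suc (nat \<bar>int n\<bar>)) * r ^ nat \<bar>int n\<bar>)"
    by simp
  have "nat \<bar>- 1 - int n\<bar> = Suc n" for n by simp
  then show "summable (\<lambda>n. real (Suc (nat \<bar>- 1 - int n\<bar>)) * r ^ nat \<bar>- 1 - int n\<bar>)"
    using * by (simp only: summable_Suc_iff[of "\<lambda>n. real (Suc n) * r ^ n"])
qed

lemma summable_norm_gaussian:
  assumes "t > 0"
  shows "summable (\<lambda>n. norm (gaussian t (w + of_int (int n))))"
    and "summable (\<lambda>n. norm (gaussian t (w + of_int (- 1 - int n))))"
proof -
  define b where "b k = real (Suc (nat \<bar>k\<bar>)) * exp (- pi * t / 2) ^ nat \<bar>k\<bar>" for k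
  have le: "norm (gaussian t (w + of_int k)) \<le> exp (pi * t * (norm w)\<^sup>2) * b k" for k
  proof -
    have "norm (gaussian t (w + of_int k)) \<le>
        exp (pi * t * (norm w)\<^sup>2) * exp (- pi * t / 2) ^ nat \<bar>k\<bar>"
      using assms by (rule norm_gaussian_le) simp
    also have "\<dots> \<le> exp (pi * t * (norm w)\<^sup>2) * b k"
      unfolding b_def by (intro mult_left_mono) (auto simp: mult_le_cancel_right1)
    finally show ?thesis .
  qed
  note sb = summable_Suc_power_int[of "exp (- pi * t / 2)", folded b_def]
  show "summable (\<lambda>n. norm (gaussian t (w + of_int (int n))))"
  proof (rule summable_comparison_test'[where N = 0])
    show "summable (\<lambda>n. exp (pi * t * (norm w)\<^sup>2) * b (int n))"
      using assms by (intro summable_mult sb) auto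
  qed (unfold real_norm_def abs_norm_cancel, rule le)
  show "summable (\<lambda>n. norm (gaussian t (w + of_int (- 1 - int n))))"
  proof (rule summable_comparison_test'[where N = 0])
    show "summable (\<lambda>n. exp (pi * t * (norm w)\<^sup>2) * b (- 1 - int n))"
      using assms by (intro summable_mult sb) auto
  qed (unfold real_norm_def abs_norm_cancel, rule le)
qed

definition gaussian_lattice_sum :: "real \<Rightarrow> complex \<Rightarrow> complex" where
  "gaussian_lattice_sum t w =
    (\<Sum>n. gaussian t (w + of_int (int n)) + gaussian t (w + of_int (- 1 - int n)))"

lemma gaussian_lattice_sums:
  assumes "t > 0"
  shows "(\<lambda>n. gaussian t (w + of_int (int n)) + gaussian t (w + of_int (- 1 - int n)))
    sums gaussian_lattice_sum t w"
  unfolding gaussian_lattice_sum_def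
  by (intro summable_sums summable_add summable_norm_gaussian[THEN summable_norm_cancel] assms)

text \<open>
The shift moves the term \<open>gaussian t w\<close> from the series over \<open>n \<ge> 0\<close> to the series over \<open>n < 0\<close>.
\<close>

lemma gaussian_lattice_sum_periodic:
  assumes "t > 0"
  shows "gaussian_lattice_sum t (w + 1) = gaussian_lattice_sum t w"
proof -
  note s = summable_norm_gaussian[OF assms, THEN summable_norm_cancel]
  have eq: "gaussian_lattice_sum t v =
      (\<Sum>n. gaussian t (v + of_int (int n))) + (\<Sum>n. gaussian t (v + of_int (- 1 - int n)))" for v
    unfolding gaussian_lattice_sum_def by (rule suminf_add[symmetric]) (rule s)+
  have "(\<Sum>n. gaussian t (w + 1 + of_int (int n))) =
      (\<Sum>n. gaussian t (w + of_int (int (Suc n))))"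
    by (simp add: add_ac)
  also have "\<dots> = (\<Sum>n. gaussian t (w + of_int (int n))) - gaussian t w"
    using suminf_split_head[OF s(1), of w] by simp
  finally have 1: "(\<Sum>n. gaussian t (w + 1 + of_int (int n))) =
    (\<Sum>n. gaussian t (w + of_int (int n))) - gaussian t w" .
  have "(\<Sum>n. gaussian t (w + of_int (- 1 - int n))) =
      (\<Sum>n. gaussian t (w + 1 + of_int (- 1 - int (Suc n))))"
    by (simp add: algebra_simps)
  also have "\<dots> = (\<Sum>n. gaussian t (w + 1 + of_int (- 1 - int n))) - gaussian t w"
    using suminf_split_head[OF s(2), of "w + 1"] by simp
  finally have 2: "(\<Sum>n. gaussian t (w + 1 + of_int (- 1 - int n))) =
    (\<Sum>n. gaussian t (w + of_int (- 1 - int n))) + gaussian t w" by simp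
  show ?thesis unfolding eq 1 2 by simp
qed

lemma gaussian_lattice_sum_lipschitz:
  assumes t: "t > 0"
  obtains L where "\<And>w w'. norm w \<le> R \<Longrightarrow> norm w' \<le> R \<Longrightarrow>
    norm (gaussian_lattice_sum t w - gaussian_lattice_sum t w') \<le> L * norm (w - w')"
proof -
  define b where "b k = real (Suc (nat \<bar>k\<bar>)) * exp (- pi * t / 2) ^ nat \<bar>k\<bar>" for k
  define C where "C = 2 * pi * t * (R + 1) * exp (pi * t * R\<^sup>2)"
  define L where "L = (\<Sum>n. C * b (int n) + C * b (- 1 - int n))"
  note sb = summable_Suc_power_int[of "exp (- pi * t / 2)", folded b_def]
  have sL: "summable (\<lambda>n. C * b (int n) + C * b (- 1 - int n))"
    using t by (intro summable_add summable_mult sb) auto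
  have "norm (gaussian_lattice_sum t w - gaussian_lattice_sum t w') \<le> L * norm (w - w')"
    if w: "norm w \<le> R" "norm w' \<le> R" for w w'
  proof -
    define d where "d k = gaussian t (w + of_int k) - gaussian t (w' + of_int k)" for k
    have d: "norm (d k) \<le> C * b k * norm (w - w')" for k
      unfolding d_def b_def C_def by (rule gaussian_lipschitz[OF t w])
    have "(\<lambda>n. d (int n) + d (- 1 - int n)) sums
        (gaussian_lattice_sum t w - gaussian_lattice_sum t w')"
      using sums_diff[OF gaussian_lattice_sums[OF t, of w] gaussian_lattice_sums[OF t, of w']]
      unfolding d_def by (simp add: algebra_simps)
    moreover have "norm (d (int n) + d (- 1 - int n)) \<le>
        (C * b (int n) + C * b (- 1 - int n)) * norm (w - w')" for n
      by (rule order_trans[OF norm_triangle_ineq])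
         (use d[of "int n"] d[of "- 1 - int n"] in \<open>simp only: distrib_right\<close>)
    moreover have "summable (\<lambda>n. (C * b (int n) + C * b (- 1 - int n)) * norm (w - w'))"
      by (rule summable_mult2[OF sL])
    ultimately show ?thesis
      using norm_suminf_le[of "\<lambda>n. d (int n) + d (- 1 - int n)"] suminf_mult2[OF sL]
      by (auto simp: sums_iff L_def)
  qed
  then show ?thesis by (rule that)
qed

text \<open>
Unfolding: integrating the periodised function over one period amounts to integrating the original function over
the line.  Both sides are limits of the integrals over \<open>[-N, N)\<close>, by dominated convergence once
on the unit interval and once on the line.
\<close>

lemma fourier_coeff_gaussian_lattice_sum:
  assumes t: "t > 0"
  shows "fourier_coeff (\<lambda>x. gaussian_lattice_sum t (z + of_real x)) m =
    of_real (1 / sqrt t) *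
      exp (- of_real (pi * (of_int m)\<^sup>2 / t) + 2 * of_real pi * \<i> * of_int m * z)"
    (is "_ = ?I")
proof -
  define G where "G x = gaussian t (z + of_real x) * harmonic (- m) x" for x
  have G: "has_bochner_integral lborel G ?I"
    unfolding G_def by (rule has_bochner_integral_gaussian_harmonic[OF t])
  have [measurable]: "gaussian t \<in> borel_measurable borel"
    unfolding gaussian_def by (intro borel_measurable_continuous_onI continuous_intros)
  have [measurable]: "G \<in> borel_measurable borel"
    unfolding G_def by measurable
  have intG: "integrable lborel G" using G by (simp add: has_bochner_integral_iff)
  have window: "(LINT x|unit_interval. G (x + of_int k)) =
      (LINT x|lborel. indicator {of_int k..<of_int k + 1} x *\<^sub>R G x)" for k
  proof -
    have "(LINT x|lborel. indicator {of_int k..<of_int k + 1} x *\<^sub>R G x) =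
        (LINT x|lborel. indicator {of_int k..<of_int k + 1} (of_int k + x) *\<^sub>R G (of_int k + x))"
      by (subst lborel_integral_real_affine[where c = 1 and t = "of_int k"]) simp_all
    also have "\<dots> = (LINT x|lborel. indicator {0..<1} x *\<^sub>R G (x + of_int k))"
      by (intro Bochner_Integration.integral_cong refl) (auto simp: indicator_def add_ac)
    finally show ?thesis by (simp add: integral_restrict_space)
  qed
  have int_ind: "integrable lborel (\<lambda>x. indicator {a..<b} x *\<^sub>R G x)" for a b :: real
    using intG by (intro integrable_mult_indicator) auto
  have int_win: "integrable unit_interval (\<lambda>x. G (x + of_int k))" for k
  proof -
    have "integrable lborel (\<lambda>x. G (of_int k + 1 * x))"
      by (rule lborel_integrable_real_affine[OF intG]) simp
    then show ?thesis
      by (subst integrable_restrict_space) (auto simp: add.commute intro!: integrable_mult_indicator)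
  qed
  \<comment> \<open>the part of the periodisation coming from \<open>[-N, N)\<close>\<close>
  define s where "s N x = (\<Sum>n<N. G (x + of_int (int n)) + G (x + of_int (- 1 - int n)))" for N x
  have s_eq: "(LINT x|unit_interval. s N x) =
      (LINT x|lborel. indicator {- real N..<real N} x *\<^sub>R G x)" for N
  proof (induction N)
    case 0
    then show ?case by (simp add: s_def)
  next
    case (Suc N)
    have int_s: "integrable unit_interval
        (\<lambda>x. \<Sum>n<N. G (x + of_int (int n)) + G (x + of_int (- 1 - int n)))"
      by (intro Bochner_Integration.integrable_sum Bochner_Integration.integrable_add int_win)
    have "(LINT x|unit_interval. s (Suc N) x) = (LINT x|unit_interval. s N x) +
        ((LINT x|unit_interval. G (x + of_int (int N))) +
         (LINT x|unit_interval. G (x + of_int (- 1 - int N))))"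
      unfolding s_def sum.lessThan_Suc
      by (simp only: Bochner_Integration.integral_add Bochner_Integration.integrable_add
          int_s int_win)
    also have "\<dots> = (LINT x|lborel. indicator {- real N..<real N} x *\<^sub>R G x +
        (indicator {of_int (int N)..<of_int (int N) + 1} x *\<^sub>R G x +
         indicator {of_int (- 1 - int N)..<of_int (- 1 - int N) + 1} x *\<^sub>R G x))"
      unfolding Suc window
      by (simp only: Bochner_Integration.integral_add Bochner_Integration.integrable_add int_ind)
    also have "\<dots> = (LINT x|lborel. indicator {- real (Suc N)..<real (Suc N)} x *\<^sub>R G x)"
      by (intro Bochner_Integration.integral_cong refl) (auto simp: indicator_def)
    finally show ?case .
  qed
  have "(\<lambda>N. LINT x|lborel. indicator {- real N..<real N} x *\<^sub>R G x) \<longlonglongrightarrow> (LINT x|lborel. G x)"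
  proof (rule integral_dominated_convergence[where w = "\<lambda>x. norm (G x)"])
    show "AE x in lborel. (\<lambda>N. indicator {- real N..<real N} x *\<^sub>R G x) \<longlonglongrightarrow> G x"
    proof (intro AE_I2 tendsto_eventually)
      fix x :: real
      show "\<forall>\<^sub>F N in sequentially. indicator {- real N..<real N} x *\<^sub>R G x = G x"
        using eventually_gt_at_top[of "nat \<lceil>\<bar>x\<bar>\<rceil>"]
        by eventually_elim (auto simp: indicator_def, linarith+)
    qed
  qed (use intG in \<open>auto simp: indicator_def\<close>)
  then have lim1: "(\<lambda>N. LINT x|unit_interval. s N x) \<longlonglongrightarrow> ?I"
    using G by (simp add: s_eq has_bochner_integral_iff)
  define R where "R = norm z + 1"
  define c where "c k = exp (pi * t * R\<^sup>2) * exp (- pi * t / 2) ^ nat \<bar>k\<bar>" for k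
  have Gk: "G (x + of_int k) = gaussian t (z + of_real x + of_int k) * harmonic (- m) x" for x k
    by (simp add: G_def harmonic_shift add_ac)
  have Gk_le: "norm (G (x + of_int k)) \<le> c k" if "0 \<le> x" "x < 1" for x k
  proof -
    have "norm (z + of_real x) \<le> R"
      using norm_triangle_ineq[of z "of_real x"] that by (simp add: R_def)
    then show ?thesis
      unfolding Gk c_def norm_mult norm_harmonic using norm_gaussian_le[OF t] by simp
  qed
  have c_nonneg: "c k \<ge> 0" for k by (simp add: c_def)
  have r: "exp (- pi * t / 2) < 1" using t by simp
  have "nat \<bar>- 1 - int n\<bar> = Suc n" for n by simp
  then have sc: "summable (\<lambda>n. c (int n) + c (- 1 - int n))"
    unfolding c_def using r
    by (intro summable_add summable_mult)
       (auto simp del: of_int_diff power_Suc simp: summable_Suc_iff[of "\<lambda>n. exp (- (pi * t / 2)) ^ n"]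
         intro!: summable_geometric)
  have "(\<lambda>N. LINT x|unit_interval. s N x) \<longlonglongrightarrow>
      (LINT x|unit_interval. gaussian_lattice_sum t (z + of_real x) * harmonic (- m) x)"
  proof (rule integral_dominated_convergence[where w = "\<lambda>_. \<Sum>n. c (int n) + c (- 1 - int n)"])
    show "(\<lambda>x. gaussian_lattice_sum t (z + of_real x) * harmonic (- m) x)
        \<in> borel_measurable unit_interval"
      unfolding gaussian_lattice_sum_def by (rule measurable_restrict_space1) measurable
    show "s N \<in> borel_measurable unit_interval" for N
      unfolding s_def by (rule measurable_restrict_space1) measurable
    show "AE x in unit_interval. (\<lambda>N. s N x) \<longlonglongrightarrow>
        gaussian_lattice_sum t (z + of_real x) * harmonic (- m) x"
    proof (intro AE_I2)
      fix x
      show "(\<lambda>N. s N x) \<longlonglongrightarrow> gaussian_lattice_sum t (z + of_real x) * harmonic (- m) x"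
        using sums_mult2[OF gaussian_lattice_sums[OF t, of "z + of_real x"], of "harmonic (- m) x"]
        unfolding s_def sums_def Gk distrib_right .
    qed
    show "AE x in unit_interval. norm (s N x) \<le> (\<Sum>n. c (int n) + c (- 1 - int n))" for N
    proof (intro AE_I2)
      fix x assume "x \<in> space unit_interval"
      then have x: "0 \<le> x" "x < 1" by (auto simp: space_restrict_space)
      have "norm (s N x) \<le> (\<Sum>n<N. c (int n) + c (- 1 - int n))"
        unfolding s_def
        by (intro sum_norm_le order_trans[OF norm_triangle_ineq] add_mono Gk_le x)
      also have "\<dots> \<le> (\<Sum>n. c (int n) + c (- 1 - int n))"
        using sc by (intro sum_le_suminf) (auto intro!: add_nonneg_nonneg c_nonneg)
      finally show "norm (s N x) \<le> (\<Sum>n. c (int n) + c (- 1 - int n))" .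
    qed
  qed simp
  from LIMSEQ_unique[OF this lim1] show ?thesis
    by (simp add: fourier_coeff_def)
qed

text \<open>
The transformation formula of the theta function of two variables.  The lattice sum is the value at \<open>x = 0\<close> of the periodic
function \<open>x \<mapsto> gaussian_lattice_sum t (z + x)\<close> of a real variable, hence the sum of that function's Fourier
coefficients; taking \<open>x\<close> real with \<open>z\<close> complex avoids analytic continuation in \<open>z\<close>.
\<close>

theorem theta_inversion:
  assumes t: "t > 0"
  defines "h \<equiv> \<lambda>n z. of_real (1 / sqrt t) *
    exp (- of_real (pi * (of_int n)\<^sup>2 / t) + 2 * of_real pi * \<i> * of_int n * z)"
  shows "(\<lambda>n. h (int n) z + h (- 1 - int n) z) sums gaussian_lattice_sum t z"
proof -
  define P where "P x = gaussian_lattice_sum t (z + of_real x)" for x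
  obtain L where L: "norm (gaussian_lattice_sum t w - gaussian_lattice_sum t w') \<le> L * norm (w - w')"
    if "norm w \<le> norm z + 1" "norm w' \<le> norm z + 1" for w w'
    using gaussian_lattice_sum_lipschitz[OF t, where R = "norm z + 1"] by metis
  have bound: "norm (z + of_real x) \<le> norm z + 1" if "0 \<le> x" "x \<le> 1" for x
    using norm_triangle_ineq[of z "of_real x"] that by simp
  have [measurable]: "gaussian t \<in> borel_measurable borel"
    unfolding gaussian_def by (intro borel_measurable_continuous_onI continuous_intros)
  have "(\<lambda>n. fourier_coeff P (int n) + fourier_coeff P (- 1 - int n)) sums gaussian_lattice_sum t z"
  proof (rule fourier_series_at_0[where L = L])
    show "P \<in> borel_measurable borel"
      unfolding P_def gaussian_lattice_sum_def by measurable
    fix x :: real assume x: "0 \<le> x" "x \<le> 1"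
    show "norm (P x - gaussian_lattice_sum t z) \<le> L * x"
      using L[of "z + of_real x" z] bound[OF x] x by (simp add: P_def)
    have "norm (gaussian_lattice_sum t (z + of_real x) - gaussian_lattice_sum t (z + of_real 1)) \<le>
        L * norm ((z + of_real x) - (z + of_real 1))"
      using x by (intro L bound) auto
    also have "(z + of_real x) - (z + of_real 1) = of_real (x - 1)"
      by simp
    also have "norm (of_real (x - 1) :: complex) = 1 - x"
      unfolding norm_of_real using x by simp
    finally show "norm (P x - gaussian_lattice_sum t z) \<le> L * (1 - x)"
      by (simp add: P_def gaussian_lattice_sum_periodic[OF t])
  qed
  then show ?thesis
    unfolding P_def fourier_coeff_gaussian_lattice_sum[OF t] h_def .
qed

section \<open>The theta series behind the characters\<close>

definition singlet_term :: "nat \<Rightarrow> complex \<Rightarrow> real \<Rightarrow> real \<Rightarrow> complex" where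
  "singlet_term p \<epsilon> y u =
     exp (- 2 * of_real pi * \<epsilon> * of_real (sqrt (2 * real p) * u))
       * q_pow (\<i> * of_real y) (real p * u\<^sup>2)"

text \<open>
This is \<open>exp (\<pi> (\<epsilon> + \<i> n / sqrt (2 p))\<^sup>2 / y)\<close>.  Writing it as a value of a Gaussian makes the summability
results for Gaussians applicable.
\<close>

definition dual_term :: "nat \<Rightarrow> complex \<Rightarrow> real \<Rightarrow> int \<Rightarrow> complex" where
  "dual_term p \<epsilon> y n = gaussian (1 / (2 * real p * y)) (- \<i> * of_real (sqrt (2 * real p)) * \<epsilon> + of_int n)"

text \<open>
Completing the square in \<open>u\<close> absorbs \<open>\<epsilon>\<close> into a complex shift of the lattice.
\<close>

lemma singlet_term_eq_gaussian:
  assumes "p > 0" "y > 0"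
  shows "singlet_term p \<epsilon> y u = exp (of_real pi * \<epsilon>\<^sup>2 / of_real y) *
    gaussian (2 * real p * y) (of_real u + \<epsilon> / of_real (sqrt (2 * real p) * y))"
proof -
  define a where "a = complex_of_real (sqrt (2 * real p))"
  have a: "a\<^sup>2 = 2 * of_nat p" "a \<noteq> 0"
    using assms by (simp_all add: a_def flip: of_real_power)
  have pa: "of_nat p = a\<^sup>2 / 2" using a by simp
  show ?thesis
    unfolding singlet_term_def q_pow_def gaussian_def exp_add[symmetric]
    by (rule arg_cong[where f = exp], use assms a(2) in \<open>simp add: pa flip: a_def\<close>)
       (simp add: field_simps power2_eq_square)
qed

lemma gaussian_dual_eq:
  assumes "p > 0" "y > 0"
  shows "exp (of_real pi * \<epsilon>\<^sup>2 / of_real y) *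
     exp (- of_real (pi * (of_int n)\<^sup>2 / (2 * real p * y)) +
       2 * of_real pi * \<i> * of_int n * (of_real c + \<epsilon> / of_real (sqrt (2 * real p) * y))) =
     harmonic n c * dual_term p \<epsilon> y n"
proof -
  define a where "a = complex_of_real (sqrt (2 * real p))"
  have a: "a\<^sup>2 = 2 * of_nat p" "a \<noteq> 0"
    using assms by (simp_all add: a_def flip: of_real_power)
  have pa: "of_nat p = a\<^sup>2 / 2" using a by simp
  show ?thesis
    unfolding dual_term_def harmonic_def gaussian_def exp_add[symmetric]
    by (rule arg_cong[where f = exp], use assms a(2) in \<open>simp add: pa flip: a_def\<close>)
       (simp add: field_simps power2_eq_square)
qed

lemma singlet_term_summable:
  assumes "p > 0" "y > 0"
  shows "summable (\<lambda>k. singlet_term p \<epsilon> y (c + real k))"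
    and "summable (\<lambda>k. singlet_term p \<epsilon> y (c - 1 - real k))"
proof -
  define z where "z = of_real c + \<epsilon> / of_real (sqrt (2 * real p) * y)"
  have t: "2 * real p * y > 0" using assms by simp
  have "singlet_term p \<epsilon> y (c + of_int k) = exp (of_real pi * \<epsilon>\<^sup>2 / of_real y) *
      gaussian (2 * real p * y) (z + of_int k)" for k
    by (simp add: singlet_term_eq_gaussian[OF assms] z_def add_ac)
  then have "summable (\<lambda>k. singlet_term p \<epsilon> y (c + of_int (int k)))"
    "summable (\<lambda>k. singlet_term p \<epsilon> y (c + of_int (- 1 - int k)))"
    by (simp_all only: summable_mult summable_norm_cancel summable_norm_gaussian[OF t])
  then show "summable (\<lambda>k. singlet_term p \<epsilon> y (c + real k))"
    "summable (\<lambda>k. singlet_term p \<epsilon> y (c - 1 - real k))"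
    by (simp_all add: algebra_simps)
qed

text \<open>
Poisson summation for the terms of the characters, extended to the whole lattice \<open>c + \<int>\<close>.  Only the phase
\<open>harmonic n c\<close> remembers the offset \<open>c\<close>.
\<close>

lemma singlet_lattice_sum:
  assumes "p > 0" "y > 0"
  shows "(\<lambda>n. harmonic (int n) c * dual_term p \<epsilon> y (int n) +
      harmonic (- 1 - int n) c * dual_term p \<epsilon> y (- 1 - int n)) sums
    (of_real (sqrt (2 * real p * y)) *
      (\<Sum>k. singlet_term p \<epsilon> y (c + real k) + singlet_term p \<epsilon> y (c - 1 - real k)))"
proof -
  define z where "z = of_real c + \<epsilon> / of_real (sqrt (2 * real p) * y)"
  define t where "t = 2 * real p * y"
  have t: "t > 0" using assms by (simp add: t_def)
  define K where "K = exp (of_real pi * \<epsilon>\<^sup>2 / of_real y)"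
  have gauss: "singlet_term p \<epsilon> y (c + of_int k) = K * gaussian t (z + of_int k)" for k
    by (simp add: singlet_term_eq_gaussian[OF assms] z_def t_def K_def add_ac)
  have "(\<lambda>n. singlet_term p \<epsilon> y (c + of_int (int n)) + singlet_term p \<epsilon> y (c + of_int (- 1 - int n)))
      sums (K * gaussian_lattice_sum t z)"
    using sums_mult[OF gaussian_lattice_sums[OF t, of z], of K]
    unfolding gauss distrib_left .
  then have S: "(\<Sum>k. singlet_term p \<epsilon> y (c + real k) + singlet_term p \<epsilon> y (c - 1 - real k)) =
      K * gaussian_lattice_sum t z"
    by (simp add: sums_iff algebra_simps)
  define h where "h n = of_real (1 / sqrt t) *
    exp (- of_real (pi * (of_int n)\<^sup>2 / t) + 2 * of_real pi * \<i> * of_int n * z)" for n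
  have h: "of_real (sqrt t) * K * h n = harmonic n c * dual_term p \<epsilon> y n" for n
    using gaussian_dual_eq[OF assms, of \<epsilon> n c, folded z_def t_def K_def] t
    by (simp add: h_def)
  have "(\<lambda>n. h (int n) + h (- 1 - int n)) sums gaussian_lattice_sum t z"
    unfolding h_def by (rule theta_inversion[OF t])
  from sums_mult[OF this, of "of_real (sqrt t) * K"] show ?thesis
    unfolding S t_def[symmetric] distrib_left h by (simp only: mult.assoc)
qed

text \<open>
The two offsets are the values at \<open>k = 0\<close> of \<^const>\<open>u_minus\<close> and \<^const>\<open>u_plus\<close>.
\<close>

definition lattice_weight :: "nat \<Rightarrow> int \<Rightarrow> nat \<Rightarrow> int \<Rightarrow> complex" where
  "lattice_weight p r s n = harmonic n ((2 - real_of_int r) / 2 - real s / (2 * real p))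
     - harmonic n ((2 - real_of_int r) / 2 + real s / (2 * real p))"

lemma harmonic_half: "harmonic n (real_of_int k / 2) = (- 1) powi (n * k)"
proof -
  have "harmonic n (real_of_int k / 2) = exp (of_int (n * k) * (of_real pi * \<i>))"
    by (simp add: harmonic_def mult_ac)
  also have "\<dots> = exp (of_real pi * \<i>) powi (n * k)"
    by (rule exp_power_int[symmetric])
  finally show ?thesis by (simp only: exp_pi_i)
qed

lemma lattice_weight_eq:
  assumes "p > 0"
  shows "lattice_weight p r s n =
    - 2 * \<i> * (- 1) powi (n * r) * of_real (sin (pi * of_int n * real s / real p))"
proof -
  define x where "x = pi * of_int n * real s / real p"
  have sgn: "(- 1 :: complex) powi (n * (2 - r)) = (- 1) powi (n * r)"
    by (simp add: power_int_minus_one_diff_commute power_int_def uminus_power_if even_nat_iff)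
  have "harmonic n (real_of_int (2 - r) / 2 + v * (real s / (2 * real p))) =
      (- 1) powi (n * r) * exp (\<i> * of_real (v * x))" for v
  proof -
    have "harmonic n (real_of_int (2 - r) / 2 + v * (real s / (2 * real p))) =
      harmonic n (real_of_int (2 - r) / 2) * harmonic n (v * (real s / (2 * real p)))"
      by (simp add: harmonic_def exp_add[symmetric] algebra_simps)
    also have "harmonic n (v * (real s / (2 * real p))) = exp (\<i> * of_real (v * x))"
      using assms by (simp add: harmonic_def x_def field_simps)
    finally show ?thesis by (simp only: harmonic_half sgn)
  qed
  from this[of 1] this[of "- 1"] have "lattice_weight p r s n =
      (- 1) powi (n * r) * (exp (\<i> * of_real (- x)) - exp (\<i> * of_real x))"
    by (simp add: lattice_weight_def algebra_simps)
  also have "exp (\<i> * of_real (- x)) - exp (\<i> * of_real x) = - 2 * \<i> * of_real (sin x)"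
    by (simp add: complex_eq_iff Re_exp Im_exp)
  finally show ?thesis by (simp add: x_def)
qed

lemma lattice_weight_nonzero_imp:
  assumes "p > 0" "lattice_weight p r s n \<noteq> 0"
  shows "\<not> int p dvd n"
proof
  assume "int p dvd n"
  then obtain l where "n = int p * l" by auto
  then have "pi * of_int n * real s / real p = of_int (l * int s) * pi"
    using assms(1) by simp
  then have "sin (pi * of_int n * real s / real p) = 0"
    using sin_zero_iff_int2 by blast
  with assms show False by (simp add: lattice_weight_eq)
qed

lemma norm_lattice_weight_le: "norm (lattice_weight p r s n) \<le> 2"
  unfolding lattice_weight_def using norm_triangle_ineq4 by (rule order_trans) simp

section \<open>The dominant term as y tends to 0\<close>

definition dual_exponent :: "nat \<Rightarrow> complex \<Rightarrow> int \<Rightarrow> complex" where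
  "dual_exponent p \<epsilon> n =
     - of_real (pi / (2 * real p)) * (of_int n - \<i> * of_real (sqrt (2 * real p)) * \<epsilon>)\<^sup>2"

lemma dual_term_eq_exp: "dual_term p \<epsilon> y n = exp (dual_exponent p \<epsilon> n / of_real y)"
  by (simp add: dual_term_def gaussian_def dual_exponent_def)

lemma Re_dual_exponent:
  "Re (dual_exponent p \<epsilon> n) = pi / (2 * real p) *
     ((sqrt (2 * real p) * Re \<epsilon>)\<^sup>2 - (real_of_int n + sqrt (2 * real p) * Im \<epsilon>)\<^sup>2)"
proof -
  define a where "a = sqrt (2 * real p)"
  have "Re ((of_int n - \<i> * of_real a * \<epsilon>)\<^sup>2) = (of_int n + a * Im \<epsilon>)\<^sup>2 - (a * Re \<epsilon>)\<^sup>2"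
    by (simp add: power2_eq_square)
  moreover have "Re (- of_real c * v) = - c * Re v" for c v by simp
  ultimately show ?thesis
    unfolding dual_exponent_def a_def[symmetric] by (simp only:) (simp add: right_diff_distrib)
qed

lemma exp_divide_tendsto_0:
  assumes "c < 0"
  shows "((\<lambda>y. exp (c / y)) \<longlongrightarrow> 0) (at_right (0::real))"
proof -
  have "filterlim (\<lambda>y. c * inverse y) at_bot (at_right (0::real))"
    using assms by (intro filterlim_tendsto_neg_mult_at_bot[OF tendsto_const]
        filterlim_inverse_at_top_right)
  then show ?thesis
    unfolding divide_inverse by (rule filterlim_compose[OF exp_at_bot])
qed

text \<open>
After division by the dominant exponential every other term tends to \<open>0\<close>.  Since the real parts of the
remaining exponents are at most \<open>0\<close> and \<open>1 / y \<ge> 1\<close>, each term with \<open>y \<le> 1\<close> is bounded by its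
value at \<open>y = 1\<close>, which supplies the majorant for Tannery's theorem.
\<close>

lemma dual_series_tendsto:
  fixes w :: "int \<Rightarrow> complex"
  assumes p: "p > 0"
    and bound: "\<And>n. norm (w n) \<le> B"
    and dom: "\<And>n. w n \<noteq> 0 \<Longrightarrow> n \<noteq> n0 \<Longrightarrow> Re (dual_exponent p \<epsilon> n) < Re (dual_exponent p \<epsilon> n0)"
  shows "((\<lambda>y. \<Sum>k. (w (int k) * dual_term p \<epsilon> y (int k) +
        w (- 1 - int k) * dual_term p \<epsilon> y (- 1 - int k)) * exp (- dual_exponent p \<epsilon> n0 / of_real y))
      \<longlongrightarrow> w n0) (at_right (0::real))"
proof -
  define l where "l = dual_exponent p \<epsilon>"
  define F where "F n y = w n * dual_term p \<epsilon> y n * exp (- l n0 / of_real y)" for n and y :: real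
  define b where "b n = B * exp (- Re (l n0)) * norm (dual_term p \<epsilon> 1 n)" for n
  have B: "B \<ge> 0" using bound[of 0] norm_ge_zero[of "w 0"] by linarith
  have F_eq: "F n y = w n * exp ((l n - l n0) / of_real y)" for n y
    by (simp add: F_def dual_term_eq_exp l_def exp_add[symmetric] diff_divide_distrib)
  have norm_F: "norm (F n y) = norm (w n) * exp ((Re (l n) - Re (l n0)) / y)" for n y
    by (simp add: F_eq norm_mult norm_exp_eq_Re Re_divide_of_real)
  have lim_F: "(F n \<longlongrightarrow> (if n = n0 then w n0 else 0)) (at_right 0)" for n
  proof (cases "n = n0 \<or> w n = 0")
    case True
    then have "F n = (\<lambda>y. if n = n0 then w n0 else 0)" by (auto simp: F_eq)
    then show ?thesis by simp
  next
    case False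
    then have "Re (l n) - Re (l n0) < 0" using dom[of n] by (simp add: l_def)
    from tendsto_mult_right_zero[OF exp_divide_tendsto_0[OF this], of "norm (w n)"]
    have "((\<lambda>y. norm (F n y)) \<longlongrightarrow> 0) (at_right 0)" unfolding norm_F .
    then show ?thesis using False by (simp add: tendsto_norm_zero_iff)
  qed
  have F_le: "norm (F n y) \<le> b n" if y: "0 < y" "y \<le> 1" for n y
  proof (cases "w n = 0")
    case True
    then show ?thesis using B by (simp add: F_eq b_def)
  next
    case False
    then have "Re (l n) - Re (l n0) \<le> 0" using dom[of n] by (cases "n = n0") (auto simp: l_def)
    then have "(Re (l n) - Re (l n0)) / y \<le> Re (l n) - Re (l n0)"
      using y mult_left_mono_neg[of y 1 "Re (l n) - Re (l n0)"] by (simp add: divide_le_eq)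
    then have "norm (F n y) \<le> B * exp (Re (l n) - Re (l n0))"
      unfolding norm_F using B bound by (intro mult_mono) auto
    also have "\<dots> = b n"
      by (simp add: b_def dual_term_eq_exp l_def norm_exp_eq_Re exp_diff exp_minus divide_inverse)
    finally show ?thesis .
  qed
  have t: "1 / (2 * real p * 1) > 0" using p by simp
  have sb: "summable (\<lambda>k. b (int k) + b (- 1 - int k))"
    unfolding b_def dual_term_def by (intro summable_add summable_mult summable_norm_gaussian[OF t])
  have ev: "\<forall>\<^sub>F y in at_right (0::real). 0 < y \<and> y \<le> 1"
    unfolding eventually_at_right[OF zero_less_one] by (intro exI[of _ 1]) auto
  have "((\<lambda>y. \<Sum>k. F (int k) y + F (- 1 - int k) y) \<longlongrightarrow>
     (\<Sum>k. (if int k = n0 then w n0 else 0) + (if - 1 - int k = n0 then w n0 else 0))) (at_right 0)"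
  proof (rule tannerys_theorem[THEN conjunct2, THEN conjunct2, OF _ _ sb])
    show "((\<lambda>y. F (int k) y + F (- 1 - int k) y) \<longlongrightarrow>
      (if int k = n0 then w n0 else 0) + (if - 1 - int k = n0 then w n0 else 0)) (at_right 0)" for k
      by (intro tendsto_add lim_F)
    have "\<forall>\<^sub>F (k::nat, y) in at_top \<times>\<^sub>F at_right (0::real). 0 < y \<and> y \<le> 1"
      using ev by (subst eventually_prod2) auto
    then show "\<forall>\<^sub>F (k, y) in at_top \<times>\<^sub>F at_right 0.
        norm (F (int k) y + F (- 1 - int k) y) \<le> b (int k) + b (- 1 - int k)"
      by (rule eventually_mono)
         (auto intro!: order_trans[OF norm_triangle_ineq] add_mono F_le)
  qed simp
  also have "(\<Sum>k. (if int k = n0 then w n0 else 0) + (if - 1 - int k = n0 then w n0 else 0)) = w n0"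
  proof -
    \<comment> \<open>the position of \<open>n0\<close> in the enumeration of the integers by the pairs \<open>k\<close>, \<open>-1 - k\<close>\<close>
    define k0 where "k0 = (if n0 \<ge> 0 then nat n0 else nat (- 1 - n0))"
    have "(if int k = n0 then w n0 else 0) + (if - 1 - int k = n0 then w n0 else 0) =
        (if k = k0 then w n0 else 0)" for k
      by (auto simp: k0_def)
    then show ?thesis using sums_single[of k0 "\<lambda>_. w n0"] by (simp add: sums_iff)
  qed
  finally show ?thesis by (simp add: F_def l_def distrib_right)
qed

text \<open>
Dropping the factor \<open>exp (-2 \<pi> y p u\<^sup>2) \<le> 1\<close> gives a bound independent of \<open>y\<close>, geometric with a ratio
below \<open>1\<close> when \<open>Re \<epsilon> < 0\<close>.
\<close>

lemma norm_singlet_term_negative_le: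
  assumes "y > 0"
  shows "norm (singlet_term p \<epsilon> y (c - 1 - real k)) \<le>
    exp (- 2 * pi * Re \<epsilon> * sqrt (2 * real p) * (c - 1)) *
      exp (2 * pi * Re \<epsilon> * sqrt (2 * real p)) ^ k"
proof -
  define u where "u = c - 1 - real k"
  have "norm (singlet_term p \<epsilon> y u) =
      exp (- 2 * pi * Re \<epsilon> * sqrt (2 * real p) * u) * exp (- 2 * pi * y * (real p * u\<^sup>2))"
    by (simp add: singlet_term_def q_pow_def norm_mult norm_exp_eq_Re mult_ac)
  also have "\<dots> \<le> exp (- 2 * pi * Re \<epsilon> * sqrt (2 * real p) * u) * 1"
    using assms by (intro mult_left_mono) auto
  also have "\<dots> = exp (- 2 * pi * Re \<epsilon> * sqrt (2 * real p) * (c - 1)) *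
      exp (2 * pi * Re \<epsilon> * sqrt (2 * real p)) ^ k"
    by (simp add: u_def exp_add[symmetric] exp_of_nat_mult[symmetric] algebra_simps)
  finally show ?thesis by (simp add: u_def)
qed

lemma negative_half_bounded:
  assumes p: "p > 0" and "Re \<epsilon> < 0"
  obtains C where "\<And>y. y > 0 \<Longrightarrow> norm (\<Sum>k. singlet_term p \<epsilon> y (c - 1 - real k)) \<le> C"
proof
  fix y :: real assume y: "y > 0"
  have r: "exp (2 * pi * Re \<epsilon> * sqrt (2 * real p)) < 1"
    using assms by (simp add: mult_neg_pos mult_pos_neg)
  show "norm (\<Sum>k. singlet_term p \<epsilon> y (c - 1 - real k)) \<le>
      (\<Sum>k. exp (- 2 * pi * Re \<epsilon> * sqrt (2 * real p) * (c - 1)) *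
        exp (2 * pi * Re \<epsilon> * sqrt (2 * real p)) ^ k)"
    using r by (intro norm_suminf_le norm_singlet_term_negative_le y summable_mult summable_geometric) auto
qed

definition singlet_sum :: "nat \<Rightarrow> int \<Rightarrow> nat \<Rightarrow> complex \<Rightarrow> real \<Rightarrow> complex" where
  "singlet_sum p r s \<epsilon> y =
     (\<Sum>k. singlet_term p \<epsilon> y (u_minus p r s k) - singlet_term p \<epsilon> y (u_plus p r s k))"

lemma reg_char_eq_singlet_sum:
  "reg_char p r s \<epsilon> (\<i> * of_real y) = singlet_sum p r s \<epsilon> y / dedekind_eta (\<i> * of_real y)"
  by (simp add: reg_char_def singlet_sum_def singlet_term_def)

text \<open>
The half-lattice sum is the full lattice sum minus the complementary half.  After scaling, the former converges to the weight of
the dominant term.  The latter is bounded, the exponential in the scaling factor has norm at most \<open>1\<close>,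
and the factor \<open>sqrt (2 p y)\<close> makes it vanish.
\<close>

lemma singlet_sum_tendsto:
  assumes p: "p > 0" and neg: "Re \<epsilon> < 0"
    and dom: "\<And>n. \<not> int p dvd n \<Longrightarrow> n \<noteq> n0 \<Longrightarrow>
      Re (dual_exponent p \<epsilon> n) < Re (dual_exponent p \<epsilon> n0)"
    and pos: "Re (dual_exponent p \<epsilon> n0) \<ge> 0"
  shows "((\<lambda>y. of_real (sqrt (2 * real p * y)) * exp (- dual_exponent p \<epsilon> n0 / of_real y) *
      singlet_sum p r s \<epsilon> y) \<longlongrightarrow> lattice_weight p r s n0) (at_right 0)"
proof -
  define cm where "cm = (2 - real_of_int r) / 2 - real s / (2 * real p)"
  define cp where "cp = (2 - real_of_int r) / 2 + real s / (2 * real p)"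
  define w where "w = lattice_weight p r s"
  have w: "w n = harmonic n cm - harmonic n cp" for n
    by (simp add: w_def lattice_weight_def cm_def cp_def)
  define D where "D = (\<lambda>y n. dual_term p \<epsilon> y n)"
  define E where "E y = exp (- dual_exponent p \<epsilon> n0 / of_real y)" for y :: real
  define S where "S c y = (\<Sum>k. singlet_term p \<epsilon> y (c + real k))" for c y
  define N where "N c y = (\<Sum>k. singlet_term p \<epsilon> y (c - 1 - real k))" for c y
  have half: "of_real (sqrt (2 * real p * y)) * E y * singlet_sum p r s \<epsilon> y =
      (\<Sum>k. (w (int k) * D y (int k) + w (- 1 - int k) * D y (- 1 - int k)) * E y)
      - of_real (sqrt (2 * real p * y)) * E y * (N cm y - N cp y)" if y: "y > 0" for y
  proof -
    note summ = singlet_term_summable[OF p y, of \<epsilon>]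
    have full: "(\<Sum>k. singlet_term p \<epsilon> y (c + real k) + singlet_term p \<epsilon> y (c - 1 - real k)) =
        S c y + N c y" for c
      unfolding S_def N_def by (rule suminf_add[symmetric]) (rule summ)+
    have eq: "singlet_sum p r s \<epsilon> y = S cm y - S cp y"
      unfolding singlet_sum_def S_def
      by (subst suminf_diff[OF summ(1) summ(1)])
         (simp add: u_minus_def u_plus_def cm_def cp_def algebra_simps)
    have "(\<lambda>k. (w (int k) * D y (int k) + w (- 1 - int k) * D y (- 1 - int k)) * E y) sums
        (of_real (sqrt (2 * real p * y)) * ((S cm y + N cm y) - (S cp y + N cp y)) * E y)"
      using sums_mult2[OF sums_diff[OF singlet_lattice_sum[OF p y, where c = cm and \<epsilon> = \<epsilon>]
          singlet_lattice_sum[OF p y, where c = cp and \<epsilon> = \<epsilon>]], of "E y"]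
      unfolding full by (simp add: w D_def algebra_simps)
    from sums_unique[OF this, symmetric] show ?thesis
      unfolding eq by (simp only:) (simp add: algebra_simps)
  qed
  obtain C1 C2 where C: "\<And>y. y > 0 \<Longrightarrow> norm (N cm y) \<le> C1" "\<And>y. y > 0 \<Longrightarrow> norm (N cp y) \<le> C2"
    using negative_half_bounded[OF p neg] unfolding N_def by metis
  have "((\<lambda>y. of_real (sqrt (2 * real p * y)) * E y * (N cm y - N cp y)) \<longlongrightarrow> 0) (at_right 0)"
  proof (rule Lim_null_comparison)
    show "\<forall>\<^sub>F y in at_right 0. norm (of_real (sqrt (2 * real p * y)) * E y * (N cm y - N cp y)) \<le>
        sqrt (2 * real p * y) * 1 * (C1 + C2)"
      using eventually_at_right_less[of 0]
    proof eventually_elim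
      case (elim y)
      have "norm (E y) \<le> 1"
        using elim pos by (simp add: E_def norm_exp_eq_Re Re_divide_of_real)
      moreover have "norm (N cm y - N cp y) \<le> C1 + C2"
        using C[OF elim] norm_triangle_ineq4[of "N cm y" "N cp y"] by linarith
      ultimately show ?case
        using elim unfolding norm_mult by (intro mult_mono) auto
    qed
    have "((\<lambda>y. sqrt (2 * real p * y) * 1 * (C1 + C2)) \<longlongrightarrow> sqrt (2 * real p * 0) * 1 * (C1 + C2))
        (at_right 0)"
      by (intro tendsto_intros)
    then show "((\<lambda>y. sqrt (2 * real p * y) * 1 * (C1 + C2)) \<longlongrightarrow> 0) (at_right 0)" by simp
  qed
  moreover have "((\<lambda>y. \<Sum>k. (w (int k) * D y (int k) + w (- 1 - int k) * D y (- 1 - int k)) * E y)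
      \<longlongrightarrow> w n0) (at_right 0)"
    unfolding D_def E_def
    by (rule dual_series_tendsto[OF p, where B = 2])
       (auto simp: w_def norm_lattice_weight_le dest: lattice_weight_nonzero_imp[OF p] intro: dom)
  ultimately have "((\<lambda>y. (\<Sum>k. (w (int k) * D y (int k) + w (- 1 - int k) * D y (- 1 - int k)) * E y)
      - of_real (sqrt (2 * real p * y)) * E y * (N cm y - N cp y)) \<longlongrightarrow> w n0 - 0) (at_right 0)"
    by (intro tendsto_diff)
  moreover have "\<forall>\<^sub>F y in at_right 0. (\<Sum>k. (w (int k) * D y (int k) + w (- 1 - int k) * D y (- 1 - int k)) * E y)
      - of_real (sqrt (2 * real p * y)) * E y * (N cm y - N cp y) =
      of_real (sqrt (2 * real p * y)) * E y * singlet_sum p r s \<epsilon> y"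
    using eventually_at_right_less[of 0] by eventually_elim (simp add: half)
  ultimately show ?thesis
    unfolding w_def E_def by (simp add: Lim_transform_eventually)
qed

lemma dedekind_eta_nonzero:
  assumes "Im \<tau> > 0"
  shows "dedekind_eta \<tau> \<noteq> 0"
proof -
  define q where "q = exp (2 * of_real pi * \<i> * \<tau>)"
  have q: "norm q < 1" using assms by (simp add: q_def norm_exp_eq_Re)
  have pow: "exp (2 * of_real pi * \<i> * \<tau> * of_nat n) = q ^ n" for n
    by (simp add: q_def exp_of_nat2_mult)
  have "summable (\<lambda>n. norm ((1 - q ^ Suc n) - 1))"
    using q by (simp add: norm_power norm_mult summable_mult summable_geometric)
  then have "convergent_prod (\<lambda>n. 1 - q ^ Suc n)"
    by (intro abs_convergent_prod_imp_convergent_prod summable_imp_abs_convergent_prod)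
  moreover have "1 - q ^ Suc n \<noteq> 0" for n
  proof
    assume "1 - q ^ Suc n = 0"
    then have "norm (q ^ Suc n) = 1" by simp
    then show False using q power_less_one_iff[of "norm q" "Suc n"] by (simp add: norm_power norm_mult)
  qed
  ultimately have "(\<Prod>n. 1 - q ^ Suc n) \<noteq> 0" by (rule prodinf_nonzero)
  then show ?thesis unfolding dedekind_eta_def pow by simp
qed

text \<open>
The Dedekind eta function and the scaling factor, both nonzero and common to the two modules, cancel in the quotient.
\<close>

theorem has_reg_qdim_dominant:
  assumes p: "p > 0" and neg: "Re \<epsilon> < 0"
    and dom: "\<And>n. \<not> int p dvd n \<Longrightarrow> n \<noteq> n0 \<Longrightarrow>
      Re (dual_exponent p \<epsilon> n) < Re (dual_exponent p \<epsilon> n0)"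
    and pos: "Re (dual_exponent p \<epsilon> n0) \<ge> 0"
    and vac: "lattice_weight p 1 1 n0 \<noteq> 0"
  shows "has_reg_qdim p r s \<epsilon> (lattice_weight p r s n0 / lattice_weight p 1 1 n0)"
proof -
  define X where "X y = of_real (sqrt (2 * real p * y)) * exp (- dual_exponent p \<epsilon> n0 / of_real y)"
    for y :: real
  note lim = singlet_sum_tendsto[OF p neg dom pos, folded X_def]
  have eta: "dedekind_eta (\<i> * of_real y) \<noteq> 0" if "y > 0" for y
    using that by (intro dedekind_eta_nonzero) simp
  have "\<forall>\<^sub>F y in at_right 0. X y * singlet_sum p 1 1 \<epsilon> y \<noteq> 0"
    by (rule tendsto_imp_eventually_ne[OF lim vac])
  then have "\<forall>\<^sub>F y in at_right 0. reg_char p 1 1 \<epsilon> (\<i> * of_real y) \<noteq> 0"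
    using eventually_at_right_less[of 0]
    by eventually_elim (simp add: reg_char_eq_singlet_sum eta)
  moreover have "((\<lambda>y. reg_char p r s \<epsilon> (\<i> * of_real y) / reg_char p 1 1 \<epsilon> (\<i> * of_real y))
      \<longlongrightarrow> lattice_weight p r s n0 / lattice_weight p 1 1 n0) (at_right 0)"
  proof (rule Lim_transform_eventually[OF tendsto_divide[OF lim lim vac]])
    show "\<forall>\<^sub>F y in at_right 0. X y * singlet_sum p r s \<epsilon> y / (X y * singlet_sum p 1 1 \<epsilon> y) =
        reg_char p r s \<epsilon> (\<i> * of_real y) / reg_char p 1 1 \<epsilon> (\<i> * of_real y)"
      using eventually_at_right_less[of 0]
    proof eventually_elim
      case (elim y)
      then have "X y \<noteq> 0" using p by (simp add: X_def)
      then show ?case using eta[OF elim] by (simp add: reg_char_eq_singlet_sum)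
    qed
  qed
  ultimately show ?thesis by (simp add: has_reg_qdim_def)
qed

section \<open>Quantum dimensions on the strips\<close>

text \<open>
The dual index enters as \<open>-n\<close> because \<open>Re (dual_exponent p \<epsilon> (-n))\<close> decreases with the distance of \<open>n\<close> from
\<open>sqrt (2 p) Im \<epsilon>\<close>.
\<close>

lemma lattice_weight_ratio:
  assumes "p > 0"
  shows "lattice_weight p r s (- n) / lattice_weight p 1 1 (- n) =
    (- 1) powi (n * (r - 1)) *
      of_real (sin (pi * real_of_int n * real s / real p) / sin (pi * real_of_int n / real p))"
proof -
  have "(- 1 :: complex) powi (- n * r) = (- 1) powi (n * (r - 1)) * (- 1) powi (- n * 1)"
    by (simp add: right_diff_distrib power_int_minus_one_minus flip: power_int_add)
  then show ?thesis
    by (simp add: lattice_weight_eq[OF assms])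
qed

lemma sin_multiple_of_pi_plus:
  "sin (of_int k * pi + x) = (if even k then 1 else - 1) * sin x"
proof -
  have "sin (of_int k * pi) = 0" using sin_npi_int[of k] by (simp add: mult.commute)
  moreover have "cos (of_int k * pi) = (if even k then 1 else - 1)"
    using cos_npi_int[of k] by (simp add: mult.commute)
  ultimately show ?thesis by (simp add: sin_add)
qed

lemma minus_one_powi: "(- 1 :: complex) powi n = (if even n then 1 else - 1)"
  by (auto simp: power_int_def uminus_power_if even_nat_iff)

theorem proposition12:
  fixes p s m :: nat and r k :: int and \<epsilon> :: complex
  assumes "p \<ge> 2"
    and "1 \<le> s" and "s \<le> p"
    and "m \<in> {0..2 * p - 1}"
    and "\<epsilon> \<in> strip p k m"
    and "Re \<epsilon> < reg_bound p \<epsilon>"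
    and off_centre: "m = 0 \<or> m = p \<Longrightarrow>
      Im \<epsilon> / sqrt (2 * real p) \<noteq> real_of_int k + real m / (2 * real p)"
  shows "has_reg_qdim p r s \<epsilon>
    (if m \<noteq> 0 \<and> m \<noteq> p
     then (- 1) powi (int m * (r - 1)) *
            of_real (sin (pi * real m * real s / real p) / sin (pi * real m / real p))
     else (- 1) powi ((int m + 1) * (r - 1) + int (m div p) * (int s - 1)) *
            of_real (sin (pi * real s / real p) / sin (pi / real p)))"
proof -
  have p: "p > 0" using assms(1) by simp
  define a where "a = sqrt (2 * real p)"
  have a: "a > 0" "a * a = 2 * real p" using p by (auto simp: a_def)
  define X where "X = a * Im \<epsilon>"
  define N where "N = 2 * int p * k + int m"
  have X_div: "Im \<epsilon> / a = X / (2 * real p)"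
    unfolding a(2)[symmetric] X_def using a(1) by simp
  have N_real: "real_of_int N = 2 * real p * real_of_int k + real m"
    by (simp add: N_def)
  have XN: "\<bar>X - real_of_int N\<bar> < 1 / 2"
  proof -
    have "real_of_int k + (2 * real m - 1) / (4 * real p) = (real_of_int N - 1 / 2) / (2 * real p)"
      "real_of_int k + (2 * real m + 1) / (4 * real p) = (real_of_int N + 1 / 2) / (2 * real p)"
      using p by (simp_all add: N_real field_simps)
    then have "(real_of_int N - 1 / 2) / (2 * real p) < X / (2 * real p)"
      "X / (2 * real p) < (real_of_int N + 1 / 2) / (2 * real p)"
      using assms(5) unfolding strip_def mem_Collect_eq a_def[symmetric] X_div by simp_all
    then have "real_of_int N - 1 / 2 < X" "X < real_of_int N + 1 / 2"
      using p by (simp_all add: divide_less_cancel)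
    then show ?thesis by linarith
  qed
  have N_dvd: "int p dvd N \<longleftrightarrow> m = 0 \<or> m = p"
  proof -
    have "int p dvd N \<longleftrightarrow> p dvd m" by (simp add: N_def dvd_add_right_iff)
    also have "\<dots> \<longleftrightarrow> m = 0 \<or> m = p"
    proof
      assume "p dvd m"
      then obtain d where "m = p * d" by auto
      have "m < p * 2" using assms(4) p by (simp only: atLeastAtMost_iff) linarith
      with \<open>m = p * d\<close> have "d < 2" by simp
      then show "m = 0 \<or> m = p" using \<open>m = p * d\<close> by (auto simp: less_2_cases_iff)
    qed auto
    finally show ?thesis .
  qed
  have X_ne_N: "X \<noteq> real_of_int N" if "m = 0 \<or> m = p"
    using off_centre[OF that] p unfolding a_def[symmetric] X_div N_real by (auto simp: field_simps)
  \<comment> \<open>When \<open>p\<close> divides \<open>N\<close>, the term with index \<open>N\<close> has weight \<open>0\<close>, and the second nearest integer to \<open>X\<close> takes over.\<close>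
  define \<sigma> :: int where "\<sigma> = (if m \<noteq> 0 \<and> m \<noteq> p then 0 else if X > real_of_int N then 1 else - 1)"
  define M where "M = N + \<sigma>"
  have M_ndvd: "\<not> int p dvd M"
  proof (cases "m = 0 \<or> m = p")
    case True
    then have "int p dvd M \<longleftrightarrow> int p dvd \<sigma>" using N_dvd by (simp add: M_def dvd_add_right_iff)
    then show ?thesis using True assms(1) by (auto simp: \<sigma>_def)
  next
    case False
    then show ?thesis using N_dvd by (simp add: M_def \<sigma>_def)
  qed
  have nearest: "\<bar>X - real_of_int M\<bar> < \<bar>X - real_of_int j\<bar>" if j: "\<not> int p dvd j" "j \<noteq> M" for j
  proof (cases "m = 0 \<or> m = p")
    case True
    then have "j \<noteq> N" using j N_dvd by auto
    then have "j \<le> N - 1 \<or> j \<ge> N + 1" by linarith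
    then have "real_of_int j \<le> real_of_int N - 1 \<or> real_of_int j \<ge> real_of_int N + 1" by linarith
    moreover have "j \<le> N - 2 \<or> j \<ge> N" if "\<sigma> = - 1" using that j by (auto simp: M_def)
    ultimately show ?thesis
      using True XN X_ne_N j by (auto simp: M_def \<sigma>_def abs_if split: if_splits)
  next
    case False
    then have "j \<le> N - 1 \<or> j \<ge> N + 1" using j by (auto simp: M_def \<sigma>_def)
    then have "real_of_int j \<le> real_of_int N - 1 \<or> real_of_int j \<ge> real_of_int N + 1" by linarith
    then show ?thesis
      using False XN by (auto simp: M_def \<sigma>_def abs_if split: if_splits)
  qed
  obtain m' where m': "\<not> int p dvd m'" "reg_bound p \<epsilon> = - \<bar>real_of_int m' / a - Im \<epsilon>\<bar>"
    using reg_bound_attained[OF assms(1)] unfolding a_def by blast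
  have "\<bar>real_of_int m' / a - Im \<epsilon>\<bar> = \<bar>X - real_of_int m'\<bar> / a"
    using a(1) by (simp add: X_def abs_if field_simps)
  moreover have "\<bar>X - real_of_int M\<bar> \<le> \<bar>X - real_of_int m'\<bar>"
    using nearest[OF m'(1)] by (cases "m' = M") auto
  \<comment> \<open>the hypothesis on \<open>Re \<epsilon>\<close>, scaled by \<open>a\<close>: the dominant exponent has positive real part\<close>
  ultimately have Re_lt: "a * Re \<epsilon> < - \<bar>X - real_of_int M\<bar>"
    using assms(6) m'(2) a(1) by (simp add: field_simps)
  then have neg: "Re \<epsilon> < 0"
    using a(1) by (smt (verit) mult_nonneg_nonneg)
  have Re_eq: "Re (dual_exponent p \<epsilon> n) = pi / (2 * real p) *
      ((a * Re \<epsilon>)\<^sup>2 - (X - real_of_int (- n))\<^sup>2)" for n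
    by (simp add: Re_dual_exponent a_def X_def add.commute)
  have "has_reg_qdim p r s \<epsilon> (lattice_weight p r s (- M) / lattice_weight p 1 1 (- M))"
  proof (rule has_reg_qdim_dominant[OF p neg])
    fix n assume n: "\<not> int p dvd n" "n \<noteq> - M"
    then have "\<bar>X - real_of_int M\<bar> < \<bar>X - real_of_int (- n)\<bar>"
      by (intro nearest) auto
    then have "(X - real_of_int M)\<^sup>2 < (X - real_of_int (- n))\<^sup>2"
      by (metis not_le abs_le_square_iff)
    then show "Re (dual_exponent p \<epsilon> n) < Re (dual_exponent p \<epsilon> (- M))"
      unfolding Re_eq using p by (intro mult_strict_left_mono) auto
  next
    have "(X - real_of_int M)\<^sup>2 \<le> (a * Re \<epsilon>)\<^sup>2"
      using Re_lt by (intro abs_le_square_iff[THEN iffD1]) auto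
    then show "Re (dual_exponent p \<epsilon> (- M)) \<ge> 0"
      unfolding Re_eq using p by simp
  next
    show "lattice_weight p 1 1 (- M) \<noteq> 0"
    proof
      assume "lattice_weight p 1 1 (- M) = 0"
      then have "sin (pi * real_of_int M / real p) = 0"
        by (simp add: lattice_weight_eq[OF p])
      then obtain i :: int where "pi * real_of_int M / real p = real_of_int i * pi"
        by (auto simp: sin_zero_iff_int2)
      then have "real_of_int M = real_of_int (int p * i)" using p by (simp add: field_simps)
      then have "M = int p * i" by (simp only: of_int_eq_iff)
      with M_ndvd show False by simp
    qed
  qed
  also have "lattice_weight p r s (- M) / lattice_weight p 1 1 (- M) =
    (if m \<noteq> 0 \<and> m \<noteq> p
     then (- 1) powi (int m * (r - 1)) *
            of_real (sin (pi * real m * real s / real p) / sin (pi * real m / real p))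
     else (- 1) powi ((int m + 1) * (r - 1) + int (m div p) * (int s - 1)) *
            of_real (sin (pi * real s / real p) / sin (pi / real p)))"
  proof (cases "m = 0 \<or> m = p")
    case False
    then have M: "M = N" by (simp add: M_def \<sigma>_def)
    have "sin (pi * real_of_int M * real j / real p) = sin (pi * real m * real j / real p)" for j
    proof -
      have "pi * real_of_int M * real j / real p =
          of_int (2 * k * int j) * pi + pi * real m * real j / real p"
        using p by (simp add: M N_def field_simps)
      then show ?thesis by (simp only: sin_multiple_of_pi_plus) simp
    qed
    note sines = this[of s] this[of 1]
    have "(- 1 :: complex) powi (M * (r - 1)) = (- 1) powi (int m * (r - 1))"
      by (simp add: minus_one_powi M N_def)
    with sines False show ?thesis
      unfolding lattice_weight_ratio[OF p] by simp
  next
    case True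
    define l where "l = 2 * k + int (m div p)"
    have N: "N = int p * l" using True p by (auto simp: N_def l_def algebra_simps)
    have \<sigma>: "\<sigma> = 1 \<or> \<sigma> = - 1" using True by (simp add: \<sigma>_def)
    have "sin (pi * real_of_int M * real j / real p) =
        (if even (l * int j) then 1 else - 1) * (of_int \<sigma> * sin (pi * real j / real p))" for j
    proof -
      have "pi * real_of_int M * real j / real p =
          of_int (l * int j) * pi + of_int \<sigma> * (pi * real j / real p)"
        using p by (simp add: M_def N field_simps)
      moreover have "sin (of_int \<sigma> * x) = of_int \<sigma> * sin x" for x :: real
        using \<sigma> by auto
      ultimately show ?thesis by (simp only: sin_multiple_of_pi_plus)
    qed
    note sines = this[of s] this[of 1]
    have "even M \<longleftrightarrow> even (int m + 1)"
      using \<sigma> by (auto simp: M_def N_def)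
    moreover have "even l \<longleftrightarrow> even (int (m div p))"
      by (simp add: l_def)
    ultimately show ?thesis
      using True \<sigma> sines unfolding lattice_weight_ratio[OF p] minus_one_powi by auto
  qed
  finally show ?thesis .
qed

end
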